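(* Let $M,N\ge1$. The push-forward of the uniform distribution $\mathbb P_{\mathrm W,M,N}$ on $W_{M,N}$ under the map $S:W_{M,N}\to\Omega_M^{(N)}$ (the shape under the RSK correspondence) is given by $$\mathbb P_{\mathrm W,M,N}[S^{-1}(\lambda)]=\mathbb P_{\mathrm{Ch},M,N}[\{\lambda\}]:=\frac{N!}{M^N}\Bigl(\prod_{j=1}^{M-1}\frac1{j!}\Bigr)V_M(\lambda)^2W_M(\lambda),\qquad\lambda\in\Omega_M^{(N)}.$$ The Poissonization of this measure is the Charlier ensemble: for $\alpha>0$ and $\lambda\in\Omega_M$ with $\sum_j\lambda_j=N$ one has $e^{-\alpha}\frac{\alpha^N}{N!}\mathbb P_{\mathrm{Ch},M,N}[\{\lambda\}]=\mathbb P_{\mathrm{Ch},M}^\alpha[\{\lambda\}]$. Consequently, for every $t$, $$\mathbb P_{\mathrm W,M,N}[L(w)\le t]=\mathbb P_{\mathrm{Ch},M,N}[\lambda_1\le t],$$ and for the Poissonized word problem, $$\mathbb P_{\mathrm W,M}^\alpha[L(w)\le t]:=\sum_{N=0}^\infty e^{-\alpha}\frac{\alpha^N}{N!}\,\mathbb P_{\mathrm W,M,N}[L(w)\le t]=\mathbb P_{\mathrm{Ch},M}^\alpha[\lambda_1\le t].$$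
   Context: $\mathbb N=\{0,1,2,\dots\}$. A word of length $N$ on $M$ letters is a map $w:\{1,\dots,N\}\to\{1,\dots,M\}$; $W_{M,N}$ is the set of all such words, and $\mathbb P_{\mathrm W,M,N}$ is the uniform distribution on it (all $M^N$ words equally likely; for $N=0$ there is only the empty word, with $L=0$). A weakly increasing subsequence of $w$ is $w(i_1)\le\dots\le w(i_m)$ with $i_1<\dots<i_m$; $L(w)$ is the length of a longest one. $\Omega_M=\{\lambda\in\mathbb N^M:\lambda_1\ge\dots\ge\lambda_M\}$, $\Omega_M^{(N)}=\{\lambda\in\Omega_M:\sum_{j=1}^M\lambda_j=N\}$ (identified with partitions of $N$ with at most $M$ nonzero parts). The Robinson–Schensted–Knuth (RSK) correspondence (row insertion) is a bijection from $W_{M,N}$ to pairs $(P,Q)$ of Young tableaux of the same shape $\lambda$, a partition of $N$, with $P$ semistandard with entries in $\{1,\dots,M\}$ and $Q$ standard with entries $\{1,\dots,N\}$; necessarily $\lambda$ has at most $M$ rows, and $L(w)=\lambda_1$. $S(w)=\lambda\in\Omega_M^{(N)}$ is this common shape. $V_M(\lambda)=\prod_{1\le i<j\le M}(\lambda_i-\lambda_j+j-i)$, $W_M(\lambda)=\prod_{i=1}^M\frac1{(\lambda_i+M-i)!}$. The Charlier ensemble is the probability measure on $\Omega_M$ $$\mathbb P_{\mathrm{Ch},M}^\alpha[\{\lambda\}]=\Bigl(\prod_{j=1}^{M-1}\frac1{j!}\Bigr)V_M(\lambda)^2W_M(\lambda)\prod_{i=1}^M\Bigl[\Bigl(\frac{\alpha}{M}\Bigr)^{\lambda_i}e^{-\alpha/M}\Bigr].$$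 *)

theory Defs
  imports "HOL-Probability.Probability"
begin

definition words :: "nat \<Rightarrow> nat \<Rightarrow> (nat \<Rightarrow> nat) set" where
  "words M N = {1..N} \<rightarrow>\<^sub>E {1..M}"

definition word_measure :: "nat \<Rightarrow> nat \<Rightarrow> (nat \<Rightarrow> nat) measure" where
  "word_measure M N = uniform_count_measure (words M N)"

text \<open>The function \<open>i\<close> lists the positions of a weakly increasing subsequence of length \<open>m\<close>
  of the word \<open>w\<close> of length \<open>N\<close>.\<close>

definition longest_increasing :: "nat \<Rightarrow> (nat \<Rightarrow> nat) \<Rightarrow> nat" where
  "longest_increasing N w =
     Max {m. \<exists>i. strict_mono_on {1..m} i \<and> i ` {1..m} \<subseteq> {1..N} \<and> mono_on {1..m} (\<lambda>j. w (i j))}"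

text \<open>Row insertion. A tableau is its list of rows, top row first. Inserting a letter into a row
  replaces the leftmost strictly larger entry, which is returned and then inserted into the next
  row; if there is none, the letter is appended. \<open>tableau_insert\<close> also returns the (0-based) index
  of the row that has become longer; the label of the step is recorded in that row of the
  recording tableau.\<close>

fun row_insert :: "nat list \<Rightarrow> nat \<Rightarrow> nat list \<times> nat option" where
  "row_insert [] x = ([x], None)"
| "row_insert (y # ys) x =
     (if x < y then (x # ys, Some y)
      else let (zs, b) = row_insert ys x in (y # zs, b))"

fun tableau_insert :: "nat list list \<Rightarrow> nat \<Rightarrow> nat list list \<times> nat" where
  "tableau_insert [] x = ([[x]], 0)"
| "tableau_insert (r # rs) x =
     (case row_insert r x of
        (r', None) \<Rightarrow> (r' # rs, 0)
      | (r', Some y) \<Rightarrow> let (rs', i) = tableau_insert rs y in (r' # rs', Suc i))"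

definition tableau_record :: "nat list list \<Rightarrow> nat \<Rightarrow> nat \<Rightarrow> nat list list" where
  "tableau_record Q i k = (if i < length Q then Q[i := Q ! i @ [k]] else Q @ [[k]])"

text \<open>\<open>rsk N w\<close> is the pair \<open>(P, Q)\<close> obtained by inserting \<open>w 1, \<dots>, w N\<close> in this order.\<close>

primrec rsk :: "nat \<Rightarrow> (nat \<Rightarrow> nat) \<Rightarrow> nat list list \<times> nat list list" where
  "rsk 0 w = ([], [])"
| "rsk (Suc k) w =
     (let (P, Q) = rsk k w; (P', i) = tableau_insert P (w (Suc k))
      in (P', tableau_record Q i (Suc k)))"

text \<open>Elements of \<open>\<nat>\<^sup>M\<close> are functions on \<open>nat\<close> vanishing outside \<open>{1..M}\<close>; with this padding by
  zeros, row \<open>i\<close> (1-based) of a tableau has length \<open>tableau_shape T i\<close>, for every \<open>M\<close>.\<close>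

definition tableau_shape :: "nat list list \<Rightarrow> nat \<Rightarrow> nat" where
  "tableau_shape T i = (if 1 \<le> i \<and> i \<le> length T then length (T ! (i - 1)) else 0)"

definition rsk_shape :: "nat \<Rightarrow> (nat \<Rightarrow> nat) \<Rightarrow> nat \<Rightarrow> nat" where
  "rsk_shape N w = tableau_shape (fst (rsk N w))"

definition Omega :: "nat \<Rightarrow> (nat \<Rightarrow> nat) set" where
  "Omega M = {l. (\<forall>i. i \<notin> {1..M} \<longrightarrow> l i = 0) \<and> antimono_on {1..M} l}"

definition Omega_sum :: "nat \<Rightarrow> nat \<Rightarrow> (nat \<Rightarrow> nat) set" where
  "Omega_sum M N = {l \<in> Omega M. (\<Sum>j=1..M. l j) = N}"

definition V_factor :: "nat \<Rightarrow> (nat \<Rightarrow> nat) \<Rightarrow> real" where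
  "V_factor M l = (\<Prod>(i, j) \<in> {(i, j). 1 \<le> i \<and> i < j \<and> j \<le> M}.
              real (l i) - real (l j) + real j - real i)"

definition W_factor :: "nat \<Rightarrow> (nat \<Rightarrow> nat) \<Rightarrow> real" where
  "W_factor M l = (\<Prod>i=1..M. 1 / fact (l i + (M - i)))"

definition charlier_fixed :: "nat \<Rightarrow> nat \<Rightarrow> (nat \<Rightarrow> nat) measure" where
  "charlier_fixed M N = point_measure (Omega_sum M N)
     (\<lambda>l. ennreal (fact N / real M ^ N * (\<Prod>j=1..M-1. 1 / fact j) * (V_factor M l)\<^sup>2 * W_factor M l))"

definition charlier :: "real \<Rightarrow> nat \<Rightarrow> (nat \<Rightarrow> nat) measure" where
  "charlier \<alpha> M = point_measure (Omega M)
     (\<lambda>l. ennreal ((\<Prod>j=1..M-1. 1 / fact j) * (V_factor M l)\<^sup>2 * W_factor M l *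
                   (\<Prod>i=1..M. (\<alpha> / real M) ^ l i * exp (- \<alpha> / real M))))"

text \<open>\<open>P\<close> and \<open>Q\<close> have the same shape.\<close>

lemma map_length_row_insert:
  "length (fst (row_insert r x)) = (if snd (row_insert r x) = None then Suc (length r) else length r)"
  by (induction r) (auto split: prod.splits)

lemma tableau_insert_lengths:
  "tableau_insert T x = (T', i) \<Longrightarrow>
   i \<le> length T \<and>
   map length T' = (if i < length T then (map length T)[i := Suc (length (T ! i))]
                    else map length T @ [1])"
proof (induction T x arbitrary: T' i rule: tableau_insert.induct)
  case (2 r rs x)
  show ?case
    using 2 map_length_row_insert[of r x]
    by (auto split: prod.splits option.splits if_splits)
qed auto

lemma rsk_common_lengths: "map length (fst (rsk N w)) = map length (snd (rsk N w))"
proof (induction N)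
  case (Suc N)
  obtain P Q where PQ: "rsk N w = (P, Q)" by fastforce
  obtain P' i where ins: "tableau_insert P (w (Suc N)) = (P', i)" by fastforce
  have *: "map length P = map length Q" using Suc PQ by simp
  then have "length P = length Q" by (rule map_eq_imp_length_eq)
  moreover have "length (P ! i) = length (Q ! i)" if "i < length Q"
    using * that calculation by (metis nth_map)
  ultimately show ?case
    using tableau_insert_lengths[OF ins] PQ ins *
    by (auto simp: tableau_record_def map_update)
qed simp

lemma rsk_common_shape: "tableau_shape (snd (rsk N w)) = tableau_shape (fst (rsk N w))"
proof
  fix i
  have *: "map length (fst (rsk N w)) = map length (snd (rsk N w))"
    by (rule rsk_common_lengths)
  then have "length (fst (rsk N w)) = length (snd (rsk N w))" by (rule map_eq_imp_length_eq)
  with * show "tableau_shape (snd (rsk N w)) i = tableau_shape (fst (rsk N w)) i"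
    unfolding tableau_shape_def
    by (metis nth_map Suc_diff_1 Suc_le_lessD less_eq_Suc_le One_nat_def)
qed

end

theory Submission
  imports Defs "Jordan_Normal_Form.Determinant"
begin

text \<open>
  Row insertion can be undone: a semistandard tableau together with one of its corners determines the
  previous tableau and the inserted letter. Hence the number of words with a given insertion tableau
  satisfies the recursion over corners that characterizes the number of standard tableaux of that
  shape, and \<open>N! V W\<close> solves this recursion. With \<open>x\<close> the increasing sequence of the shifted parts
  \<open>l i + M - i\<close>, this is the Vandermonde identity
  \<open>\<Sum>i. x i * \<Delta>(x - e\<^sub>i) = (\<Sum>i. x i - i) * \<Delta>(x)\<close>, obtained from the Leibniz formula for the
  determinant of falling factorials. Removing the largest letter of a semistandard tableau gives
  a sum over interlacing shapes, which the determinant of binomial coefficients turns into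
  \<open>V / \<Prod>j<M. j!\<close>. The product of both counts is the number of words of a given shape.
  For the length of the longest increasing subsequence, the number of entries \<open>\<le> a\<close> in the first
  row is the maximal length of a weakly increasing subsequence with values \<open>\<le> a\<close>.
\<close>

section \<open>Vandermonde determinants\<close>

text \<open>The orientation \<open>x j - x i\<close> for \<open>i < j\<close> makes the product
  positive on strictly increasing sequences. This is why the shifted parts are later listed
  increasingly: no sign appears when comparing with \<open>V_factor\<close>.\<close>

definition vdm :: "nat \<Rightarrow> (nat \<Rightarrow> real) \<Rightarrow> real" where
  "vdm n x = (\<Prod>j<n. \<Prod>i<j. x j - x i)"

text \<open>Subtracting \<open>coeff p n\<close> times the top basis element lowers the degree, and
  the process repeats. The coefficient at \<open>n\<close> is recorded because it becomes a diagonal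
  entry of a triangular factor below; vanishing beyond \<open>n\<close> gives the zeros under that
  diagonal.\<close>

lemma monic_basis_expansion:
  fixes b :: "nat \<Rightarrow> real poly"
  assumes "\<And>k. degree (b k) = k" "\<And>k. lead_coeff (b k) = 1" "degree p \<le> n"
  shows "\<exists>u. u n = coeff p n \<and> (\<forall>k>n. u k = 0) \<and> p = (\<Sum>k\<le>n. Polynomial.smult (u k) (b k))"
  using assms(3)
proof (induction n arbitrary: p)
  case 0
  have "b 0 = 1" using assms(1)[of 0] assms(2)[of 0] by (metis degree_eq_zeroE lead_coeff_pCons(2) pCons_one)
  moreover have "Polynomial.smult (coeff p 0) 1 = p" using 0 by (metis degree_0_id le_zero_eq smult_one)
  ultimately show ?case
    by (intro exI[of _ "\<lambda>k. if k = 0 then coeff p 0 else 0"]) simp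
next
  case (Suc n)
  define q where "q = p - Polynomial.smult (coeff p (Suc n)) (b (Suc n))"
  have "degree q \<le> n"
  proof (rule degree_le, intro allI impI)
    fix i assume "n < i"
    then consider "i = Suc n" | "i > Suc n" by linarith
    then show "coeff q i = 0"
    proof cases
      case 1 then show ?thesis using assms(1,2)[of "Suc n"] by (simp add: q_def)
    next
      case 2 then show ?thesis using assms(1)[of "Suc n"] Suc.prems
        by (simp add: q_def coeff_eq_0)
    qed
  qed
  then obtain u where u: "u n = coeff q n" "\<forall>k>n. u k = 0" "q = (\<Sum>k\<le>n. Polynomial.smult (u k) (b k))"
    using Suc.IH by blast
  have "p = q + Polynomial.smult (coeff p (Suc n)) (b (Suc n))" by (simp add: q_def)
  also have "q = (\<Sum>k\<le>n. Polynomial.smult ((u(Suc n := coeff p (Suc n))) k) (b k))"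
    unfolding u(3) by (rule sum.cong) auto
  finally have "p = (\<Sum>k\<le>Suc n. Polynomial.smult ((u(Suc n := coeff p (Suc n))) k) (b k))"
    by simp
  then show ?case using u by (intro exI[of _ "u(Suc n := coeff p (Suc n))"]) auto
qed

text \<open>Expanding the polynomials in the Newton basis with nodes \<open>x\<close> factors the matrix into a lower
  and an upper triangular one.\<close>

lemma det_poly_vdm:
  fixes p :: "nat \<Rightarrow> real poly" and x :: "nat \<Rightarrow> real"
  assumes "\<And>j. degree (p j) \<le> j"
  shows "Determinant.det (Matrix.mat n n (\<lambda>(i, j). poly (p j) (x i))) = (\<Prod>j<n. coeff (p j) j) * vdm n x"
proof -
  define b where "b k = (\<Prod>i<k. [:- x i, 1:])" for k
  have b: "degree (b k) = k" "lead_coeff (b k) = 1" for k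
    unfolding b_def by (simp add: degree_prod_eq_sum_degree) (simp only: lead_coeff_prod, simp)
  have "\<forall>j. \<exists>u. u j = coeff (p j) j \<and> (\<forall>k>j. u k = 0) \<and> p j = (\<Sum>k\<le>j. Polynomial.smult (u k) (b k))"
    using monic_basis_expansion[of b, OF b assms] by blast
  then obtain u where u: "\<And>j. u j j = coeff (p j) j" "\<And>j k. k > j \<Longrightarrow> u j k = 0"
    "\<And>j. p j = (\<Sum>k\<le>j. Polynomial.smult (u j k) (b k))"
    by metis
  define T where "T = Matrix.mat n n (\<lambda>(i, k). poly (b k) (x i))"
  define U where "U = Matrix.mat n n (\<lambda>(k, j). u j k)"
  have p': "poly (p j) y = (\<Sum>k = 0..<n. poly (b k) y * u j k)" if "j < n" for j y
  proof -
    have "poly (p j) y = (\<Sum>k\<le>j. poly (b k) y * u j k)"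
      by (subst u(3)) (simp add: poly_sum mult.commute)
    also have "\<dots> = (\<Sum>k = 0..<n. poly (b k) y * u j k)"
      using that by (intro sum.mono_neutral_left) (auto simp: u(2))
    finally show ?thesis .
  qed
  have "Matrix.mat n n (\<lambda>(i, j). poly (p j) (x i)) = T * U"
    by (rule eq_matI) (auto simp: T_def U_def scalar_prod_def p')
  moreover have "Determinant.det T = (\<Prod>j<n. \<Prod>i<j. x j - x i)"
  proof (subst det_lower_triangular[of n])
    \<comment> \<open>For \<open>i < j\<close> the node \<open>x i\<close> is a root of
      \<open>b j\<close>.\<close>
    show "T $$ (i, j) = 0" if "i < j" "j < n" for i j
      using that by (auto simp: T_def b_def poly_prod)
    show "prod_list (diag_mat T) = (\<Prod>j<n. \<Prod>i<j. x j - x i)"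
      by (auto simp: prod_list_diag_prod T_def b_def poly_prod lessThan_atLeast0 intro!: prod.cong)
  qed (simp add: T_def)
  moreover have "Determinant.det U = (\<Prod>j<n. coeff (p j) j)"
  proof (subst det_upper_triangular[of _ n])
    show "upper_triangular U" by (auto simp: U_def u(2))
    show "prod_list (diag_mat U) = (\<Prod>j<n. coeff (p j) j)"
      by (auto simp: prod_list_diag_prod U_def u(1) lessThan_atLeast0 intro!: prod.cong)
  qed (simp add: U_def)
  ultimately show ?thesis
    by (subst \<open>_ = T * U\<close>, subst det_mult[of _ n]) (auto simp: T_def U_def vdm_def)
qed

text \<open>The falling factorial \<open>y (y - 1) ... (y - j + 1)\<close>, a monic basis adapted to
  the shift of \<open>y\<close> by 1.\<close>

definition falling_poly :: "nat \<Rightarrow> real poly" where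
  "falling_poly j = (\<Prod>k<j. [:- real k, 1:])"

lemma falling_poly: "degree (falling_poly j) = j" "coeff (falling_poly j) j = 1"
proof -
  show *: "degree (falling_poly j) = j"
    by (simp add: falling_poly_def degree_prod_eq_sum_degree)
  have "lead_coeff (falling_poly j) = 1" by (simp only: falling_poly_def lead_coeff_prod) simp
  then show "coeff (falling_poly j) j = 1" by (simp add: *)
qed

lemma poly_falling_poly: "poly (falling_poly j) y = fact j * (y gchoose j)"
  by (simp add: falling_poly_def poly_prod gbinomial_prod_rev lessThan_atLeast0)

text \<open>As a polynomial in \<open>y\<close>, the binomial coefficient \<open>y gchoose j\<close>
  has degree \<open>j\<close> and leading coefficient \<open>1 / fact j\<close>, so
  \<open>det_poly_vdm\<close> applies.\<close>

lemma det_gchoose: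
  "Determinant.det (Matrix.mat n n (\<lambda>(i, j). x i gchoose j)) = vdm n x / (\<Prod>j<n. fact j)"
proof -
  have "(\<lambda>(i, j). x i gchoose j) = (\<lambda>(i, j). poly (Polynomial.smult (1 / fact j) (falling_poly j)) (x i))"
    by (auto simp: poly_falling_poly)
  then have "Determinant.det (Matrix.mat n n (\<lambda>(i, j). x i gchoose j))
     = (\<Prod>j<n. coeff (Polynomial.smult (1 / fact j) (falling_poly j)) j) * vdm n x"
    by (simp only:) (rule det_poly_vdm, simp add: falling_poly)
  then show ?thesis by (simp add: falling_poly prod_dividef)
qed

text \<open>In the Leibniz expansion over falling factorials, lowering \<open>x i\<close> by 1 and
  multiplying by \<open>x i\<close> multiplies the term of \<open>p\<close> by
  \<open>x i - p i\<close>. Summed over \<open>i\<close>, this weight no longer depends on the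
  permutation \<open>p\<close>.\<close>

lemma vdm_shift_identity:
  fixes x :: "nat \<Rightarrow> real"
  shows "(\<Sum>i<n. x i * vdm n (x(i := x i - 1))) = ((\<Sum>i<n. x i) - (\<Sum>i<n. real i)) * vdm n x"
proof -
  define a where "a y j = poly (falling_poly j) y" for y j
  define P where "P = {p. p permutes {0..<n}}"
  have vdm: "vdm n y = (\<Sum>p\<in>P. of_int (sign p) * (\<Prod>k<n. a (y k) (p k)))" for y
  proof -
    have "vdm n y = Determinant.det (Matrix.mat n n (\<lambda>(i, j). a (y i) j))"
      unfolding a_def by (subst det_poly_vdm) (auto simp: falling_poly)
    also have "\<dots> = (\<Sum>p\<in>P. of_int (sign p) * (\<Prod>k<n. a (y k) (p k)))"
      unfolding P_def by (subst det_def'[of _ n])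
        (auto simp: lessThan_atLeast0 intro!: sum.cong prod.cong)
    finally show ?thesis .
  qed
  \<comment> \<open>Both sides are the falling factorial of length \<open>Suc j\<close>, with its
    first or its last factor split off.\<close>
  have step: "y * a (y - 1) j = (y - real j) * a y j" for y j
  proof -
    have "y * a (y - 1) j = (\<Prod>k<Suc j. y - real k)"
      unfolding a_def by (subst prod.lessThan_Suc_shift)
        (auto simp: falling_poly_def poly_prod algebra_simps)
    also have "\<dots> = (y - real j) * a y j"
      by (simp add: a_def falling_poly_def poly_prod mult.commute)
    finally show ?thesis .
  qed
  have "x i * vdm n (x(i := x i - 1))
      = (\<Sum>p\<in>P. (x i - real (p i)) * (of_int (sign p) * (\<Prod>k<n. a (x k) (p k))))" if "i < n" for i
  proof -
    have "x i * (\<Prod>k<n. a ((x(i := x i - 1)) k) (p k)) = (x i - real (p i)) * (\<Prod>k<n. a (x k) (p k))" for p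
    proof -
      have "(\<Prod>k\<in>{..<n} - {i}. a ((x(i := x i - 1)) k) (p k)) = (\<Prod>k\<in>{..<n} - {i}. a (x k) (p k))"
        by (rule prod.cong) auto
      then show ?thesis using that step[of "x i" "p i"]
        by (simp add: prod.remove[of "{..<n}" i] mult.assoc[symmetric])
    qed
    then show ?thesis unfolding vdm sum_distrib_left
      by (intro sum.cong refl) (metis mult.left_commute)
  qed
  then have "(\<Sum>i<n. x i * vdm n (x(i := x i - 1)))
      = (\<Sum>i<n. \<Sum>p\<in>P. (x i - real (p i)) * (of_int (sign p) * (\<Prod>k<n. a (x k) (p k))))"
    by simp
  also have "\<dots> = (\<Sum>p\<in>P. (\<Sum>i<n. x i - real (p i)) * (of_int (sign p) * (\<Prod>k<n. a (x k) (p k))))"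
    by (subst sum.swap) (simp add: sum_distrib_right)
  also have "\<dots> = (\<Sum>p\<in>P. ((\<Sum>i<n. x i) - (\<Sum>i<n. real i)) * (of_int (sign p) * (\<Prod>k<n. a (x k) (p k))))"
  proof (rule sum.cong)
    fix p assume "p \<in> P"
    \<comment> \<open>A permutation of the indices does not change their sum, so the weight is
      common to all terms.\<close>
    then have "(\<Sum>i<n. real (p i)) = (\<Sum>i<n. real i)"
      using sum.permute[of p "{0..<n}" real] by (simp add: P_def lessThan_atLeast0 o_def)
    then show "(\<Sum>i<n. x i - real (p i)) * (of_int (sign p) * (\<Prod>k<n. a (x k) (p k))) =
       ((\<Sum>i<n. x i) - (\<Sum>i<n. real i)) * (of_int (sign p) * (\<Prod>k<n. a (x k) (p k)))"
      by (simp add: sum_subtractf)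
  qed simp
  finally show ?thesis by (simp add: vdm sum_distrib_left)
qed

text \<open>By Pascal's rule the sum telescopes. It turns differences of consecutive rows of
  binomial coefficients into sums over intervals.\<close>

lemma sum_gchoose_atLeastLessThan:
  assumes "a \<le> b"
  shows "(\<Sum>m = a..<b. real m gchoose j) = (real b gchoose Suc j) - (real a gchoose Suc j)"
  using assms
proof (induction rule: dec_induct)
  case (step m)
  then show ?case using gbinomial_Suc_Suc[of "real m" j] by (simp add: add.commute)
qed simp

text \<open>Subtracting consecutive rows of the matrix of binomial coefficients clears its first column, and
  the remaining differences are sums of binomial coefficients.\<close>

lemma vdm_branching:
  fixes x :: "nat \<Rightarrow> nat"
  assumes "\<And>i. i < n \<Longrightarrow> x i \<le> x (Suc i)"
  shows "vdm (Suc n) (\<lambda>i. real (x i)) / (\<Prod>j<Suc n. fact j)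
    = (\<Sum>y\<in>(\<Pi>\<^sub>E i\<in>{..<n}. {x i..<x (Suc i)}). vdm n (\<lambda>i. real (y i)) / (\<Prod>j<n. fact j))"
proof -
  define c where "c i j = (real (x i) gchoose j)" for i j
  define A where "A = Matrix.mat (Suc n) (Suc n) (\<lambda>(i, j). c i j)"
  \<comment> \<open>Left multiplication by \<open>L\<close> keeps row 0 and subtracts from every
    other row the one above it.\<close>
  define L where "L = Matrix.mat (Suc n) (Suc n) 
    (\<lambda>(i, j). if i = j then 1 else if i = Suc j then -1 else (0::real))"
  define B where "B = Matrix.mat n n (\<lambda>(i, j). c (Suc i) (Suc j) - c i (Suc j))"
  have LA: "(L * A) $$ (i, j) = (if i = 0 then c 0 j else c i j - c (i - 1) j)" if "i < Suc n" "j < Suc n" for i j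
  proof -
    have "(L * A) $$ (i, j) = (\<Sum>k<Suc n. (if i = k then 1 else if i = Suc k then -1 else 0) * c k j)"
      using that by (simp add: L_def A_def scalar_prod_def lessThan_atLeast0)
    also have "\<dots> = (\<Sum>k<Suc n. (if i = k then c i j else 0) + (if k = i - 1 \<and> i \<noteq> 0 then - c (i - 1) j else 0))"
      by (rule sum.cong) auto
    also have "\<dots> = (if i = 0 then c 0 j else c i j - c (i - 1) j)"
      using that by (auto simp: sum.distrib)
    finally show ?thesis .
  qed
  have detL: "Determinant.det L = 1"
    by (subst det_lower_triangular[of "Suc n"])
       (auto simp: L_def prod_list_diag_prod intro!: prod.neutral)
  have AL: "A \<in> carrier_mat (Suc n) (Suc n)" "L \<in> carrier_mat (Suc n) (Suc n)" by (auto simp: A_def L_def)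
  have "vdm (Suc n) (\<lambda>i. real (x i)) / (\<Prod>j<Suc n. fact j) = Determinant.det A"
    unfolding A_def c_def by (rule det_gchoose[symmetric])
  also have "\<dots> = Determinant.det (L * A)"
    using det_mult[OF AL(2,1)] detL by simp
  also have "\<dots> = (\<Sum>i<Suc n. (L * A) $$ (i, 0) * cofactor (L * A) i 0)"
    using AL by (intro laplace_expansion_column) auto
  \<comment> \<open>Column 0 of \<open>A\<close> is constantly 1, so only its top entry survives the
    row subtractions.\<close>
  also have "\<dots> = (\<Sum>i<Suc n. if i = 0 then cofactor (L * A) 0 0 else 0)"
    by (rule sum.cong) (auto simp: LA c_def)
  also have "\<dots> = Determinant.det (mat_delete (L * A) 0 0)"
    by (simp add: cofactor_def)
  also have "mat_delete (L * A) 0 0 = B"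
  proof -
    have "mat_delete (L * A) 0 0 $$ (i, j) = B $$ (i, j)" if "i < n" "j < n" for i j
      using that mat_delete_index[of "L * A" n 0 0 i j] AL LA[of "Suc i" "Suc j"]
      by (simp add: B_def)
    then show ?thesis using AL by (intro eq_matI) (auto simp: B_def)
  qed
  also have "Determinant.det B = (\<Sum>p | p permutes {0..<n}. signof p * (\<Prod>i<n. \<Sum>m\<in>{x i..<x (Suc i)}. real m gchoose p i))"
    using assms
    by (subst det_def'[of _ n])
       (auto simp: B_def c_def sum_gchoose_atLeastLessThan lessThan_atLeast0 intro!: sum.cong prod.cong)
  \<comment> \<open>Multilinearity in the rows: expanding the product of sums chooses one
    \<open>y i\<close> from each interval.\<close>
  also have "\<dots> = (\<Sum>p | p permutes {0..<n}. \<Sum>y\<in>(\<Pi>\<^sub>E i\<in>{..<n}. {x i..<x (Suc i)}). 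
       signof p * (\<Prod>i<n. real (y i) gchoose p i))"
    by (subst prod_sum_PiE) (auto simp: sum_distrib_left)
  also have "\<dots> = (\<Sum>y\<in>(\<Pi>\<^sub>E i\<in>{..<n}. {x i..<x (Suc i)}). 
       Determinant.det (Matrix.mat n n (\<lambda>(i, j). real (y i) gchoose j)))"
    by (subst sum.swap, subst det_def'[of _ n])
       (auto simp: lessThan_atLeast0 intro!: sum.cong prod.cong)
  finally show ?thesis by (simp only: det_gchoose)
qed

section \<open>Row insertion and its inverse\<close>

abbreviation count_le :: "nat list \<Rightarrow> nat \<Rightarrow> nat" where
  "count_le r a \<equiv> length (filter (\<lambda>e. e \<le> a) r)"

abbreviation count_lt :: "nat list \<Rightarrow> nat \<Rightarrow> nat" where
  "count_lt r a \<equiv> length (filter (\<lambda>e. e < a) r)"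

lemma count_le_mono: "a \<le> b \<Longrightarrow> count_le r a \<le> count_le r b"
  by (induction r) auto

lemma count_lt_mono: "a \<le> b \<Longrightarrow> count_lt r a \<le> count_lt r b"
  by (induction r) auto

lemma count_le_le_count_lt: "a < b \<Longrightarrow> count_le r a \<le> count_lt r b"
  by (induction r) auto

lemma count_lt_less_count_le: "a \<in> set r \<Longrightarrow> count_lt r a < count_le r a"
proof (induction r)
  case (Cons e r)
  have "count_lt r a \<le> count_le r a" by (induction r) auto
  then show ?case using Cons by (auto simp: less_Suc_eq_le)
qed simp

text \<open>The last property says that no entry lies strictly between \<open>x\<close> and
  \<open>y\<close>, so \<open>y\<close> is the least entry above \<open>x\<close>. With sortedness
  and the multiset equation this describes the step completely, as \<open>row_insert_Some\<close>
  shows; later proofs use only these properties.\<close>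

lemma row_insert_SomeD:
  assumes "sorted r" "row_insert r x = (r', Some y)"
  shows "sorted r'" "x < y" "mset r' + {#y#} = mset r + {#x#}" "\<forall>e\<in>set r. e \<le> x \<or> y \<le> e"
proof -
  have "sorted r' \<and> x < y \<and> mset r' + {#y#} = mset r + {#x#} \<and> (\<forall>e\<in>set r. e \<le> x \<or> y \<le> e)"
    using assms
  proof (induction r x arbitrary: r' rule: row_insert.induct)
    case (2 e r x)
    show ?case
    proof (cases "x < e")
      case True
      have "\<forall>f\<in>set r. e \<le> f" using "2.prems" by simp
      then have "\<forall>f\<in>set r. x \<le> f" using True by (meson less_imp_le order.trans)
      then show ?thesis using True "2.prems" by auto
    next
      case False
      then obtain q where q: "row_insert r x = (q, Some y)" "r' = e # q"
        using "2.prems" by (auto split: prod.splits)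
      then have IH: "sorted q" "x < y" "mset q + {#y#} = mset r + {#x#}" "\<forall>e\<in>set r. e \<le> x \<or> y \<le> e"
        using 2 False by auto
      have "set q \<subseteq> insert x (set r)"
        using arg_cong[OF IH(3), of set_mset] by auto
      then show ?thesis using IH False q 2 by auto
    qed
  qed simp
  then show "sorted r'" "x < y" "mset r' + {#y#} = mset r + {#x#}" "\<forall>e\<in>set r. e \<le> x \<or> y \<le> e" by auto
qed

lemma row_insert_NoneD:
  "sorted r \<Longrightarrow> row_insert r x = (r', None) \<Longrightarrow> r' = r @ [x] \<and> (\<forall>e\<in>set r. e \<le> x)"
  by (induction r x arbitrary: r' rule: row_insert.induct) (auto split: prod.splits if_splits)

lemma row_insert_None: "\<forall>e\<in>set r. e \<le> x \<Longrightarrow> row_insert r x = (r @ [x], None)"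
  by (induction r) auto

text \<open>The letter actually bumped and \<open>y\<close> are both the least entry of
  \<open>r\<close> above \<open>x\<close>, hence equal. The multisets of the two result rows then
  agree, and a sorted list is determined by its multiset.\<close>

lemma row_insert_Some:
  assumes "sorted r" "sorted r'" "x < y" "mset r' + {#y#} = mset r + {#x#}"
    "\<forall>e\<in>set r. e \<le> x \<or> y \<le> e"
  shows "row_insert r x = (r', Some y)"
proof -
  obtain q b where q: "row_insert r x = (q, b)" by fastforce
  have "y \<in> set r"
    using arg_cong[OF assms(4), of set_mset] assms(3) by auto
  show ?thesis
  proof (cases b)
    case None
    then show ?thesis using row_insert_NoneD[OF assms(1)] q \<open>y \<in> set r\<close> assms(3) by force
  next
    case (Some z)
    note D = row_insert_SomeD[OF assms(1) q[unfolded Some]]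
    have "z \<in> set r"
      using arg_cong[OF D(3), of set_mset] D(2) by auto
    then have "z = y"
      using D(2,4) assms(3,5) \<open>y \<in> set r\<close> by force
    with D(3) assms(4) have "mset q = mset r'" by (metis add_right_cancel)
    then have "q = r'" using D(1) assms(2) by (metis properties_for_sort)
    then show ?thesis using q Some \<open>z = y\<close> by simp
  qed
qed

text \<open>Reverse bumping: \<open>y\<close> returns to the row and displaces the largest entry
  below \<open>y\<close>, which is the inserted letter \<open>x\<close>. The entry \<open>e\<close>
  guarantees that there is one.\<close>

lemma row_insert_reverse:
  assumes "sorted r'" "e \<in> set r'" "e < y"
  obtains r x where "sorted r" "row_insert r x = (r', Some y)"
proof -
  define x where "x = Max {e \<in> set r'. e < y}"
  have fin: "finite {e \<in> set r'. e < y}" by simp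
  have "x \<in> {e \<in> set r'. e < y}"
    unfolding x_def using assms(2,3) by (intro Max_in) auto
  then have x: "x \<in> set r'" "x < y" by auto
  have max: "e \<le> x" if "e \<in> set r'" "e < y" for e
    using that Max_ge[OF fin] by (auto simp: x_def)
  define r where "r = sorted_list_of_multiset (mset r' + {#y#} - {#x#})"
  have r: "sorted r" "mset r' + {#y#} = mset r + {#x#}"
    unfolding r_def using x by (simp_all del: sorted_list_of_multiset_insert)
  have "set r \<subseteq> insert y (set r')"
    using arg_cong[OF r(2), of set_mset] by auto
  then have "\<forall>e\<in>set r. e \<le> x \<or> y \<le> e"
    using max by (auto simp: not_less[symmetric])
  then have "row_insert r x = (r', Some y)"
    using row_insert_Some[OF r(1) assms(1) x(2) r(2)] by simp
  with r(1) show thesis by (rule that)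
qed

text \<open>The inserted letter is the largest entry of \<open>r'\<close> below \<open>y\<close>, so
  it can be read off from the output; the multiset equation then gives the old row.\<close>

lemma row_insert_inject:
  assumes "sorted r1" "sorted r2" "row_insert r1 x1 = (r', Some y)" "row_insert r2 x2 = (r', Some y)"
  shows "r1 = r2 \<and> x1 = x2"
proof -
  have le: "x \<le> u" if "sorted r" "sorted s" "row_insert r x = (r', Some y)" "row_insert s u = (r', Some y)"
    for r s x u
  proof -
    note R = row_insert_SomeD[OF that(1,3)] and S = row_insert_SomeD[OF that(2,4)]
    have "x \<in> set r'" using arg_cong[OF R(3), of set_mset] R(2) by auto
    then have "x \<in> set s \<or> x = u" using arg_cong[OF S(3), of set_mset] by auto
    then show ?thesis using S(4) R(2) by auto
  qed
  have "x1 = x2" using le[OF assms(1,2,3,4)] le[OF assms(2,1,4,3)] by simp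
  then have "mset r1 = mset r2"
    using row_insert_SomeD(3)[OF assms(1,3)] row_insert_SomeD(3)[OF assms(2,4)] by simp
  then show ?thesis using assms(1,2) \<open>x1 = x2\<close> by (metis properties_for_sort)
qed

lemma length_filter_insert:
  assumes "mset r' + {#y#} = mset r + {#x#}"
  shows "length (filter P r') + (if P y then 1 else 0) = length (filter P r) + (if P x then 1 else 0)"
  using arg_cong[OF assms, of "\<lambda>m. size (filter_mset P m)"]
  by (auto simp flip: mset_filter split: if_splits)

text \<open>If \<open>x \<le> a\<close>, the count grows exactly when every entry at most
  \<open>a\<close> is at most \<open>x\<close>, because then nothing is bumped or the bumped letter
  exceeds \<open>a\<close>. The \<open>max\<close> form is the recursion for longest increasing
  subsequences, and the same formula controls column strictness.\<close>

lemma count_le_row_insert: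
  assumes "sorted r"
  shows "count_le (fst (row_insert r x)) a =
    (if x \<le> a then max (count_le r a) (Suc (count_le r x)) else count_le r a)"
proof -
  obtain q b where q: "row_insert r x = (q, b)" by fastforce
  have same: "count_le r a = count_le r x" if "\<forall>e\<in>set r. e \<le> x \<or> a < e" "x \<le> a"
    using that by (intro arg_cong[of _ _ length] filter_cong) auto
  show ?thesis
  proof (cases b)
    case None
    then have "q = r @ [x]" "\<forall>e\<in>set r. e \<le> x" using row_insert_NoneD[OF assms] q by auto
    then show ?thesis using q same by (auto simp: max_def)
  next
    case (Some y)
    note D = row_insert_SomeD[OF assms q[unfolded Some]]
    have "y \<in> set r" using arg_cong[OF D(3), of set_mset] D(2) by auto
    have ge: "Suc (count_le r x) \<le> count_le r a" if "y \<le> a"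
      using count_le_le_count_lt[OF D(2)] count_lt_less_count_le[OF \<open>y \<in> set r\<close>] count_le_mono[OF that]
      by (metis le_trans less_le_trans Suc_leI le_less_trans)
    have "count_le r a = count_le r x" if "x \<le> a" "a < y"
      using that D(4) by (intro same) auto
    then show ?thesis
      using length_filter_insert[OF D(3), of "\<lambda>e. e \<le> a"] q D(2) ge
      by (cases "y \<le> a"; cases "x \<le> a") (auto simp: max_def not_le)
  qed
qed

section \<open>Column strictness and semistandard tableaux\<close>

text \<open>For sorted rows, \<open>s\<close> fits below \<open>r\<close> with strictly increasing columns.\<close>

definition row_above :: "nat list \<Rightarrow> nat list \<Rightarrow> bool" where
  "row_above r s \<longleftrightarrow> (\<forall>a. count_le s a \<le> count_lt r a)"

lemma row_above_Nil [simp]: "row_above r []"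
  by (simp add: row_above_def)

lemma row_above_length:
  assumes "row_above r s"
  shows "length s \<le> length r"
proof -
  \<comment> \<open>\<open>sum_list s\<close> serves as an upper bound for all entries of
    \<open>s\<close>.\<close>
  have "filter (\<lambda>e. e \<le> sum_list s) s = s"
    by (auto simp: filter_id_conv member_le_sum_list)
  then have "length s \<le> count_lt r (sum_list s)"
    using assms by (metis row_above_def)
  then show ?thesis using length_filter_le le_trans by blast
qed

text \<open>Below \<open>y\<close> the lower row's counts stay and the upper ones do not drop. At
  \<open>y\<close> both rows gain one. Beyond \<open>y\<close> the upper counts stay, and the old
  occurrence of \<open>y\<close> in \<open>r\<close> leaves room for the new entry of
  \<open>s\<close>.\<close>

lemma row_above_row_insert:
  assumes "sorted r" "sorted s" "row_above r s" "row_insert r x = (r', Some y)"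
  shows "row_above r' (fst (row_insert s y))"
  unfolding row_above_def
proof
  fix a
  note D = row_insert_SomeD[OF assms(1,4)]
  have "y \<in> set r" using arg_cong[OF D(3), of set_mset] D(2) by auto
  have above: "count_le s b \<le> count_lt r b" for b using assms(3) by (simp add: row_above_def)
  have c: "count_lt r' a + (if y < a then 1 else 0) = count_lt r a + (if x < a then 1 else 0)"
    using length_filter_insert[OF D(3), of "\<lambda>e. e < a"] by simp
  have "Suc (count_le s y) \<le> count_lt r a" if "y < a"
    using above[of y] count_lt_less_count_le[OF \<open>y \<in> set r\<close>] count_le_le_count_lt[OF that, of r] by simp
  then show "count_le (fst (row_insert s y)) a \<le> count_lt r' a"
    using c above[of a] above[of y] D(2) count_le_row_insert[OF assms(2), of a y]
    by (cases "a < y"; cases "a = y"; simp)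
qed

text \<open>Going back, the upper row loses a count only for \<open>x < a \<le> y\<close>. There
  \<open>count_lt r\<close> is constant, since no entry of \<open>r\<close> lies strictly between
  \<open>x\<close> and \<open>y\<close>, so it suffices to compare at \<open>y\<close>, where both
  rows had gained one.\<close>

lemma row_above_row_insert_reverse:
  assumes "sorted r" "sorted s" "row_insert r x = (r', Some y)" "row_above r' (fst (row_insert s y))"
  shows "row_above r s"
  unfolding row_above_def
proof
  fix a
  note D = row_insert_SomeD[OF assms(1,3)]
  note ins = count_le_row_insert[OF assms(2), where x = y]
  have above: "count_le (fst (row_insert s y)) b \<le> count_lt r' b" for b
    using assms(4) by (simp add: row_above_def)
  have c: "count_lt r' b + (if y < b then 1 else 0) = count_lt r b + (if x < b then 1 else 0)" for b
    using length_filter_insert[OF D(3), of "\<lambda>e. e < b"] by simp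
  show "count_le s a \<le> count_lt r a"
  proof (cases "x < a \<and> a \<le> y")
    case True
    have "count_le s a \<le> count_le s y" using True count_le_mono by blast
    also have "\<dots> \<le> count_lt r y" using above[of y] ins[of y] c[of y] D(2) by simp
    also have "\<dots> = count_lt r a"
      using D(4) True by (intro arg_cong[of _ _ length] filter_cong) auto
    finally show ?thesis .
  next
    case False
    then show ?thesis using above[of a] ins[of a] c[of a] D(2) by (auto split: if_splits)
  qed
qed

text \<open>The empty row as default lets an empty remainder be treated like a row: every row is
  above it, and inserting into it creates a one-letter row.\<close>

fun first_row :: "nat list list \<Rightarrow> nat list" where
  "first_row [] = []"
| "first_row (r # T) = r"

fun ssyt :: "nat list list \<Rightarrow> bool" where
  "ssyt [] \<longleftrightarrow> True"
| "ssyt (r # T) \<longleftrightarrow> r \<noteq> [] \<and> sorted r \<and> row_above r (first_row T) \<and> ssyt T"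

lemma sorted_first_row: "ssyt T \<Longrightarrow> sorted (first_row T)"
  by (cases T) auto

lemma first_row_tableau_insert:
  "first_row (fst (tableau_insert T x)) = fst (row_insert (first_row T) x)"
  by (cases T) (auto split: prod.splits option.splits)

lemma row_above_snoc:
  assumes "row_above r s"
  shows "row_above (r @ [x]) s"
  using assms by (auto simp: row_above_def intro: le_SucI)

lemma ssyt_tableau_insert: "ssyt T \<Longrightarrow> ssyt (fst (tableau_insert T x))"
proof (induction T x rule: tableau_insert.induct)
  case (2 r T x)
  obtain r' b where r': "row_insert r x = (r', b)" by fastforce
  show ?case
  proof (cases b)
    case None
    then show ?thesis
      using 2 r' row_insert_NoneD[of r x r'] by (auto simp: row_above_snoc sorted_append)
  next
    case (Some y)
    have "length r' = length r" using map_length_row_insert[of r x] r' Some by simp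
    then have "r' \<noteq> []" using "2.prems" by auto
    moreover have "row_above r' (first_row (fst (tableau_insert T y)))"
      unfolding first_row_tableau_insert
      using row_above_row_insert[of r "first_row T" x r' y] "2.prems" r' Some sorted_first_row by auto
    ultimately show ?thesis
      using 2 r' Some row_insert_SomeD(1)[of r x r' y] by (auto split: prod.splits)
  qed
qed simp

lemma mset_tableau_insert:
  "ssyt T \<Longrightarrow> mset (concat (fst (tableau_insert T x))) = mset (concat T) + {#x#}"
proof (induction T x rule: tableau_insert.induct)
  case (2 r T x)
  obtain r' b where r': "row_insert r x = (r', b)" by fastforce
  show ?case
  proof (cases b)
    case None
    then show ?thesis using row_insert_NoneD[of r x r'] r' 2 by auto
  next
    case (Some y)
    then have "mset r' + {#y#} = mset r + {#x#}" 
      using row_insert_SomeD(3)[of r x r' y] 2 r' by auto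
    then show ?thesis using Some r' 2 by (auto split: prod.splits)
  qed
qed simp

section \<open>Shapes, corners, and undoing an insertion\<close>

lemma tableau_shape_Nil [simp]: "tableau_shape [] = (\<lambda>_. 0)"
  by (auto simp: tableau_shape_def)

lemma tableau_shape_0 [simp]: "tableau_shape T 0 = 0"
  by (auto simp: tableau_shape_def)

lemma tableau_shape_Cons [simp]:
  "tableau_shape (r # T) (Suc k) = (if k = 0 then length r else tableau_shape T k)"
  by (cases k) (auto simp: tableau_shape_def)

text \<open>The row index returned by \<open>tableau_insert\<close> starts at 0, whereas shapes are
  indexed from 1; hence \<open>Suc i\<close>.\<close>

lemma tableau_shape_insert:
  "tableau_insert T x = (T', i) \<Longrightarrow>
   tableau_shape T' = (tableau_shape T)(Suc i := Suc (tableau_shape T (Suc i)))"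
proof (induction T x arbitrary: T' i rule: tableau_insert.induct)
  case (1 x)
  then show ?case by (auto simp: fun_eq_iff tableau_shape_def)
next
  case (2 r T x)
  obtain r' b where r': "row_insert r x = (r', b)" by fastforce
  show ?case
  proof
    fix k
    show "tableau_shape T' k = ((tableau_shape (r # T))(Suc i := Suc (tableau_shape (r # T) (Suc i)))) k"
      using 2 r' map_length_row_insert[of r x]
      by (cases k; cases b) (auto split: prod.splits)
  qed
qed

lemma tableau_shape_first_row: "tableau_shape T (Suc 0) = length (first_row T)"
  by (cases T) auto

lemma tableau_shape_antimono: "ssyt T \<Longrightarrow> 1 \<le> i \<Longrightarrow> tableau_shape T (Suc i) \<le> tableau_shape T i"
proof (induction T arbitrary: i)
  case (Cons r T)
  then obtain j where i: "i = Suc j" by (cases i) auto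
  show ?case
  proof (cases j)
    case 0
    then show ?thesis using Cons.prems row_above_length[of r "first_row T"]
      by (simp add: i tableau_shape_first_row)
  next
    case (Suc k)
    then show ?thesis using Cons by (simp add: i)
  qed
qed simp

text \<open>Row lengths were weakly decreasing before the step, so the row that grew is now strictly
  longer than the next one.\<close>

lemma tableau_insert_corner:
  assumes "ssyt T" "tableau_insert T x = (T', i)"
  shows "tableau_shape T' (Suc (Suc i)) < tableau_shape T' (Suc i)"
  using tableau_shape_antimono[OF assms(1), of "Suc i"] unfolding tableau_shape_insert[OF assms(2)]
  by simp

text \<open>The last letter of the corner row is removed and then bumped backwards through the rows
  above it. The induction first undoes the insertion into the lower rows, which yields the letter
  \<open>y\<close> to be sent back into the top row.\<close>

lemma tableau_insert_surj:
  "ssyt T' \<Longrightarrow> tableau_shape T' (Suc (Suc i)) < tableau_shape T' (Suc i) \<Longrightarrow>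
   \<exists>T x. ssyt T \<and> tableau_insert T x = (T', i)"
proof (induction T' arbitrary: i)
  case (Cons r' T')
  show ?case
  proof (cases i)
    case 0
    define r x where "r = butlast r'" and "x = last r'"
    have r: "r' = r @ [x]" using Cons.prems by (simp add: r_def x_def)
    have len: "length (first_row T') < length r'"
      using Cons.prems 0 by (simp add: tableau_shape_first_row)
    have ins: "row_insert r x = (r', None)"
      using Cons.prems by (auto simp: r sorted_append row_insert_None)
    show ?thesis
    proof (cases "r = []")
      case True
      \<comment> \<open>Removing its only letter deletes the row; as it was strictly longer than the
        next one, nothing stands below it.\<close>
      then have "first_row T' = []" using len r by simp
      then have "T' = []" using Cons.prems by (cases T') auto
      then show ?thesis using True r 0 by (intro exI[of _ "[]"] exI[of _ x]) simp
    next
      case False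
      \<comment> \<open>If \<open>x < a\<close>, all of \<open>r\<close> is counted and the strict
        length inequality suffices; otherwise the removed letter \<open>x\<close> was not counted in
        the first place.\<close>
      have "row_above r (first_row T')"
        unfolding row_above_def
      proof
        fix a
        have "count_le (first_row T') a \<le> count_lt r' a"
          using Cons.prems by (simp add: row_above_def)
        moreover have "count_le (first_row T') a \<le> length r"
          using len r by (intro le_trans[OF length_filter_le]) simp
        moreover have "filter (\<lambda>e. e < a) r = r" if "x < a"
          using Cons.prems that by (auto simp: r sorted_append filter_id_conv)
        ultimately show "count_le (first_row T') a \<le> count_lt r a"
          by (cases "x < a") (auto simp: r)
      qed
      then show ?thesis
        using False ins Cons.prems 0 r
        by (intro exI[of _ "r # T'"] exI[of _ x]) (auto simp: sorted_append)
    qed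
  next
    case (Suc j)
    then obtain T y where T: "ssyt T" "tableau_insert T y = (T', j)"
      using Cons.IH[of j] Cons.prems by auto
    have fr: "first_row T' = fst (row_insert (first_row T) y)"
      using first_row_tableau_insert[of T y] T by simp
    \<comment> \<open>The letter \<open>y\<close> lies in the first row of \<open>T'\<close>, so
      column strictness yields an entry of \<open>r'\<close> below \<open>y\<close>, as reverse
      bumping requires.\<close>
    have "0 < count_le (first_row T') y"
      unfolding fr count_le_row_insert[OF sorted_first_row[OF T(1)]] by simp
    also have "\<dots> \<le> count_lt r' y" using Cons.prems by (simp add: row_above_def)
    finally obtain e where "e \<in> set r'" "e < y" 
      by (metis (mono_tags, lifting) filter_empty_conv length_greater_0_conv)
    then obtain r x where r: "sorted r" "row_insert r x = (r', Some y)"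
      using row_insert_reverse[of r' e y] Cons.prems by auto
    have "length r' = length r" using map_length_row_insert[of r x] r by simp
    then have "r \<noteq> []" using Cons.prems by auto
    moreover have "row_above r (first_row T)"
      using row_above_row_insert_reverse[OF r(1) sorted_first_row[OF T(1)] r(2)] Cons.prems fr by simp
    ultimately have "ssyt (r # T)" using r(1) T(1) by simp
    moreover have "tableau_insert (r # T) x = (r' # T', i)" using r T Suc by simp
    ultimately show ?thesis by blast
  qed
qed simp

text \<open>In row 0 the inserted letter is the last one. For a deeper row the induction hypothesis
  recovers the lower rows and the bumped letter, and \<open>row_insert_inject\<close> then recovers
  the top row.\<close>

lemma tableau_insert_inject:
  "ssyt S \<Longrightarrow> ssyt T \<Longrightarrow> tableau_insert S x = (T', i) \<Longrightarrow> tableau_insert T y = (T', i) \<Longrightarrow> S = T \<and> x = y"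
proof (induction i arbitrary: S T T' x y)
  case 0
  have *: "\<exists>r. T' = (r @ [x]) # tl S \<and> r = first_row S \<and> (S = [] \<longleftrightarrow> r = [])"
    if "ssyt S" "tableau_insert S x = (T', 0)" for S x
    using that by (cases S) (auto split: prod.splits option.splits dest: row_insert_NoneD)
  show ?case
    using *[OF 0(1,3)] *[OF 0(2,4)] by (cases S; cases T; auto)
next
  case (Suc i)
  have *: "\<exists>r U r' U' z. S = r # U \<and> T' = r' # U' \<and> row_insert r x = (r', Some z) \<and> tableau_insert U z = (U', i)"
    if "tableau_insert S x = (T', Suc i)" for S x
    using that by (cases S) (auto split: prod.splits option.splits)
  obtain r U r' U' z where S: "S = r # U" "T' = r' # U'" "row_insert r x = (r', Some z)" "tableau_insert U z = (U', i)"
    using *[OF Suc.prems(3)] by blast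
  obtain q V v where T: "T = q # V" "row_insert q y = (r', Some v)" "tableau_insert V v = (U', i)"
    using *[OF Suc.prems(4)] S(2) by auto
  have "U = V \<and> z = v" using Suc.IH[of U V z U' v] Suc.prems S T by simp
  then show ?case using row_insert_inject[of r q x r' z y] Suc.prems S T by simp
qed

section \<open>Words with a given insertion tableau\<close>

lemma vdm_eq_0:
  assumes "i < j" "j < n" "x i = x j"
  shows "vdm n x = 0"
proof -
  have "(\<Prod>i<j. x j - x i) = 0" using assms by (intro prod_zero bexI[of _ i]) auto
  then show ?thesis unfolding vdm_def using assms by (intro prod_zero) auto
qed

lemma vdm_cong: "(\<And>i. i < n \<Longrightarrow> x i = y i) \<Longrightarrow> vdm n x = vdm n y"
  unfolding vdm_def by (intro prod.cong) auto

lemma bij_betw_diff_lessThan: "bij_betw (\<lambda>k. M - k) {1..M} {..<M::nat}"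
  by (rule bij_betw_byWitness[where f' = "\<lambda>k. M - k"]) auto

lemma bij_betw_diff_lessThan': "bij_betw (\<lambda>k. M - k) {..<M::nat} {1..M}"
  by (rule bij_betw_byWitness[where f' = "\<lambda>k. M - k"]) auto

text \<open>The strictly decreasing sequence \<open>l i + M - i\<close>, listed increasingly from index 0.\<close>

definition shifted :: "nat \<Rightarrow> (nat \<Rightarrow> nat) \<Rightarrow> nat \<Rightarrow> nat" where
  "shifted M l k = l (M - k) + k"

text \<open>Replacing \<open>i\<close> by \<open>M - i\<close> reverses the order, so the pair
  \<open>(i, j)\<close> turns into \<open>(M - j, M - i)\<close> and the signs agree.\<close>

lemma V_factor_eq_vdm: "V_factor M l = vdm M (\<lambda>k. real (shifted M l k))"
proof -
  have "V_factor M l = (\<Prod>(j, i)\<in>(SIGMA j:{..<M}. {..<j}). real (shifted M l j) - real (shifted M l i))"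
    unfolding V_factor_def
    by (rule prod.reindex_bij_witness[where i = "\<lambda>(j, i). (M - j, M - i)" and j = "\<lambda>(i, j). (M - i, M - j)"])
       (auto simp: shifted_def of_nat_diff)
  then show ?thesis by (simp add: vdm_def prod.Sigma)
qed

lemma W_factor_eq: "W_factor M l = (\<Prod>k<M. 1 / fact (shifted M l k))"
  unfolding W_factor_def shifted_def
  by (subst prod.reindex_bij_betw[OF bij_betw_diff_lessThan, symmetric]) (auto intro!: prod.cong)

text \<open>Frobenius' formula for the number of standard tableaux of shape \<open>l\<close>. Here
  it appears as the number of words with a given insertion tableau of that shape.\<close>

definition std_count :: "nat \<Rightarrow> (nat \<Rightarrow> nat) \<Rightarrow> real" where
  "std_count M l = fact (\<Sum>j=1..M. l j) * V_factor M l * W_factor M l"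

lemma Omega_antimono: "l \<in> Omega M \<Longrightarrow> 1 \<le> i \<Longrightarrow> i \<le> j \<Longrightarrow> l j \<le> l i"
  by (cases "j \<le> M") (auto simp: Omega_def monotone_on_def)

lemma Omega_eq_0: "l \<in> Omega M \<Longrightarrow> M < i \<Longrightarrow> l i = 0"
  by (auto simp: Omega_def)

text \<open>Removing a box from a row lowers one shifted part \<open>x k\<close> by 1, and the
  factorial in \<open>W_factor\<close> then contributes the factor \<open>x k\<close>. Rows that are
  not corners contribute zero, so the sum extends to all rows and becomes
  \<open>vdm_shift_identity\<close>.\<close>

lemma sum_std_count_remove_corner:
  assumes "l \<in> Omega M" "(\<Sum>j=1..M. l j) = Suc n"
  shows "(\<Sum>i | l (Suc (Suc i)) < l (Suc i). std_count M (l(Suc i := l (Suc i) - 1))) = std_count M l"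
proof -
  define x where "x k = real (shifted M l k)" for k
  define f where "f k = x k * vdm M (x(k := x k - 1))" for k
  have corner_less: "i < M" if "l (Suc (Suc i)) < l (Suc i)" for i
    using that Omega_eq_0[OF assms(1), of "Suc i"] by (cases "i < M") auto
  have summand: "std_count M (l(Suc i := l (Suc i) - 1)) = fact n * W_factor M l * f (M - Suc i)"
    if "l (Suc (Suc i)) < l (Suc i)" for i
  proof -
    define k where "k = M - Suc i"
    define l' where "l' = l(Suc i := l (Suc i) - 1)"
    have k: "k < M" "M - k = Suc i" using corner_less[OF that] by (auto simp: k_def)
    have pos: "l (Suc i) > 0" using that by auto
    have eq: "M - j = Suc i \<longleftrightarrow> j = k" if "j < M" for j using that k by auto
    have xk: "shifted M l k = Suc (shifted M l' k)"
      using pos k by (auto simp: l'_def shifted_def)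
    have xj: "shifted M l' j = shifted M l j" if "j < M" "j \<noteq> k" for j
      using that eq[of j] by (auto simp: l'_def shifted_def)
    have "(\<Sum>j=1..M. l j) = Suc (\<Sum>j=1..M. l' j)"
    proof -
      have "Suc i \<in> {1..M}" using k by auto
      moreover have "sum l' ({1..M} - {Suc i}) = sum l ({1..M} - {Suc i})"
        by (rule sum.cong) (auto simp: l'_def)
      ultimately show ?thesis
        using pos sum.remove[of "{1..M}" "Suc i" l] sum.remove[of "{1..M}" "Suc i" l']
        by (simp add: l'_def)
    qed
    then have "(\<Sum>j=1..M. l' j) = n" using assms(2) by simp
    moreover have "V_factor M l' = vdm M (x(k := x k - 1))"
      unfolding V_factor_eq_vdm by (rule vdm_cong) (auto simp: x_def xk xj)
    moreover have "W_factor M l' = W_factor M l * x k"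
    proof -
      have "(\<Prod>j\<in>{..<M} - {k}. 1 / fact (shifted M l' j)) = (\<Prod>j\<in>{..<M} - {k}. 1 / fact (shifted M l j) :: real)"
        by (rule prod.cong) (auto simp: xj)
      moreover have "1 / fact (shifted M l' k) = 1 / fact (shifted M l k) * x k"
        unfolding x_def xk by simp
      ultimately show ?thesis
        using k(1) by (simp add: W_factor_eq prod.remove[of "{..<M}" k])
    qed
    ultimately show ?thesis
      unfolding std_count_def f_def k_def[symmetric] l'_def[symmetric] by simp
  qed
  \<comment> \<open>For an empty last row the factor \<open>x 0\<close> is zero; for two rows of
    equal length, lowering \<open>x k\<close> makes two nodes coincide.\<close>
  have zero: "f (M - Suc i) = 0" if "i < M" "\<not> l (Suc (Suc i)) < l (Suc i)" for i
  proof (cases "Suc i = M")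
    case True
    then have "l M = 0" using that Omega_eq_0[OF assms(1), of "Suc M"] by auto
    then show ?thesis using True by (simp add: f_def x_def shifted_def)
  next
    case False
    define k where "k = M - Suc i"
    have k: "0 < k" "k < M" "M - k = Suc i" "M - (k - 1) = Suc (Suc i)" using that False by (auto simp: k_def)
    have "l (Suc (Suc i)) = l (Suc i)"
      using that Omega_antimono[OF assms(1), of "Suc i" "Suc (Suc i)"] by simp
    then have "x (k - 1) = x k - 1"
      using k by (simp add: x_def shifted_def of_nat_diff)
    then have "vdm M (x(k := x k - 1)) = 0"
      using k by (intro vdm_eq_0[of "k - 1" k]) auto
    then show ?thesis by (simp add: f_def k_def[symmetric])
  qed
  \<comment> \<open>The factor in the Vandermonde identity is the size of \<open>l\<close>, because
    the shifts add up to the sum of the indices.\<close>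
  have "(\<Sum>k<M. x k) = (\<Sum>j=1..M. real (l j)) + (\<Sum>k<M. real k)"
    using sum.reindex_bij_betw[OF bij_betw_diff_lessThan', of "\<lambda>j. real (l j)"]
    by (simp add: x_def shifted_def sum.distrib)
  then have sx: "(\<Sum>k<M. x k) - (\<Sum>k<M. real k) = real (Suc n)"
    using assms(2) by (metis add_diff_cancel_right' of_nat_sum)
  have "(\<Sum>i | l (Suc (Suc i)) < l (Suc i). std_count M (l(Suc i := l (Suc i) - 1)))
      = (\<Sum>i | l (Suc (Suc i)) < l (Suc i). fact n * W_factor M l * f (M - Suc i))"
    using summand by (intro sum.cong) auto
  also have "\<dots> = (\<Sum>i<M. fact n * W_factor M l * f (M - Suc i))"
    using corner_less zero by (intro sum.mono_neutral_left) auto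
  also have "\<dots> = fact n * W_factor M l * (\<Sum>i<M. f (M - Suc i))"
    by (simp add: sum_distrib_left)
  also have "(\<Sum>i<M. f (M - Suc i)) = (\<Sum>k<M. f k)"
    by (rule sum.nat_diff_reindex)
  also have "\<dots> = real (Suc n) * V_factor M l"
    unfolding f_def vdm_shift_identity sx by (simp add: V_factor_eq_vdm x_def)
  also have "fact n * W_factor M l * (real (Suc n) * V_factor M l) = std_count M l"
    unfolding std_count_def assms(2) by simp
  finally show ?thesis .
qed

section \<open>Words and the fibers of the insertion tableau\<close>

lemma words_Suc: "words M (Suc N) = (\<lambda>(w, x). w(Suc N := x)) ` (words M N \<times> {1..M})"
proof -
  have "words M (Suc N) = (\<lambda>(x, w). w(Suc N := x)) ` ({1..M} \<times> words M N)"
    unfolding words_def by (simp add: atLeastAtMostSuc_conv PiE_insert_eq)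
  also have "\<dots> = (\<lambda>(w, x). w(Suc N := x)) ` (words M N \<times> {1..M})" by force
  finally show ?thesis .
qed

lemma finite_words [simp]: "finite (words M N)"
  by (auto simp: words_def intro: finite_PiE)

lemma card_words: "card (words M N) = M ^ N"
  by (simp add: words_def card_PiE)

lemma rsk_cong: "(\<And>i. 1 \<le> i \<Longrightarrow> i \<le> N \<Longrightarrow> v i = w i) \<Longrightarrow> rsk N v = rsk N w"
  by (induction N) auto

lemma fst_rsk_Suc: "fst (rsk (Suc N) w) = fst (tableau_insert (fst (rsk N w)) (w (Suc N)))"
  by (auto split: prod.splits)

definition ssyts :: "nat \<Rightarrow> (nat \<Rightarrow> nat) \<Rightarrow> nat list list set" where
  "ssyts M l = {T. ssyt T \<and> set (concat T) \<subseteq> {1..M} \<and> tableau_shape T = l}"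

text \<open>Column strictness raises the lower bound \<open>c\<close> on the entries by at least one
  from each row to the next, and the entries are at most \<open>M\<close>.\<close>

lemma ssyt_length_le:
  "ssyt T \<Longrightarrow> \<forall>e\<in>set (first_row T). c \<le> e \<Longrightarrow> set (concat T) \<subseteq> {..M} \<Longrightarrow> T \<noteq> [] \<Longrightarrow> length T + c \<le> Suc M"
proof (induction T arbitrary: c)
  case (Cons r T)
  show ?case
  proof (cases "T = []")
    case True
    then show ?thesis using Cons.prems by (cases r) auto
  next
    case False
    have "count_lt r c = 0" using Cons.prems by (auto simp: filter_empty_conv not_less)
    then have "count_le (first_row T) c = 0" using Cons.prems by (auto simp: row_above_def) (metis le_zero_eq length_0_conv)
    then have "\<forall>e\<in>set (first_row T). Suc c \<le> e" by (auto simp: filter_empty_conv not_le)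
    then show ?thesis using Cons.IH[of "Suc c"] Cons.prems False by auto
  qed
qed simp

lemma sum_tableau_shape: "length T \<le> M \<Longrightarrow> (\<Sum>j=1..M. tableau_shape T j) = length (concat T)"
proof (induction T arbitrary: M)
  case (Cons r T)
  then obtain K where K: "M = Suc K" "length T \<le> K" by (cases M) auto
  have "(\<Sum>j=1..M. tableau_shape (r # T) j) = (\<Sum>j=0..K. tableau_shape (r # T) (Suc j))"
    unfolding K using sum.shift_bounds_cl_Suc_ivl[of "tableau_shape (r # T)" 0 K] by simp
  also have "\<dots> = length r + (\<Sum>j=1..K. tableau_shape T j)"
    by (subst sum.atLeast_Suc_atMost) auto
  finally show ?case using Cons.IH[OF K(2)] by simp
qed simp

lemma ssyt_shape_Omega:
  assumes "ssyt T" "set (concat T) \<subseteq> {1..M}"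
  shows "tableau_shape T \<in> Omega_sum M (length (concat T))"
proof -
  have len: "length T \<le> M"
  proof (cases "T = []")
    case False
    have "set (first_row T) \<subseteq> {1..M}" using assms(2) by (cases T) auto
    then show ?thesis using ssyt_length_le[of T 1 M] assms False by (auto simp: subset_iff)
  qed simp
  have "tableau_shape T j \<le> tableau_shape T i" if "1 \<le> i" "i \<le> j" for i j
    using that(2,1) 
  proof (induction rule: dec_induct)
    case (step k)
    then show ?case using tableau_shape_antimono[OF assms(1), of k] by simp
  qed simp
  moreover have "tableau_shape T i = 0" if "i \<notin> {1..M}" for i
    using that len by (auto simp: tableau_shape_def)
  ultimately show ?thesis using sum_tableau_shape[OF len]
    by (auto simp: Omega_sum_def Omega_def monotone_on_def)
qed

lemma rsk_ssyt:
  assumes "w \<in> words M N"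
  shows "ssyt (fst (rsk N w)) \<and> set (concat (fst (rsk N w))) \<subseteq> {1..M} \<and> length (concat (fst (rsk N w))) = N"
proof -
  \<comment> \<open>The induction runs over the prefixes of the fixed word, because \<open>w\<close>
    itself need not belong to \<open>words M n\<close>.\<close>
  have "ssyt (fst (rsk n w)) \<and> set (concat (fst (rsk n w))) \<subseteq> {1..M} \<and> length (concat (fst (rsk n w))) = n"
    if "n \<le> N" for n
    using that
  proof (induction n)
    case (Suc n)
    have "w (Suc n) \<in> {1..M}" using assms Suc.prems by (auto simp: words_def)
    moreover have "mset (concat (fst (rsk (Suc n) w))) = mset (concat (fst (rsk n w))) + {#w (Suc n)#}"
      unfolding fst_rsk_Suc using Suc by (intro mset_tableau_insert) auto
    ultimately show ?case
      using Suc ssyt_tableau_insert[of "fst (rsk n w)" "w (Suc n)"] unfolding fst_rsk_Suc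
      by (metis Suc_leD Un_insert_right insert_subset mset_eq_length set_mset_add_mset_insert set_mset_mset
          size_add_mset size_mset add_mset_add_single)
  qed simp
  then show ?thesis by simp
qed

lemma rsk_shape_Omega: "w \<in> words M N \<Longrightarrow> rsk_shape N w \<in> Omega_sum M N"
  using rsk_ssyt[of w M N] ssyt_shape_Omega[of "fst (rsk N w)" M] by (auto simp: rsk_shape_def)

text \<open>For the empty shape the inner products of the Vandermonde product are factorials, and
  \<open>W_factor\<close> cancels them.\<close>

lemma std_count_0: "std_count M (\<lambda>_. 0) = 1"
proof -
  have "(\<Prod>i<j. real j - real i) = fact j" for j
  proof -
    have "(\<Prod>i<j. real j - real i) = (\<Prod>i<j. real (Suc i))"
      by (subst prod.nat_diff_reindex[symmetric]) (auto intro!: prod.cong simp: of_nat_diff)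
    then show ?thesis by (simp add: fact_prod_Suc lessThan_atLeast0)
  qed
  then show ?thesis
    by (simp add: std_count_def V_factor_eq_vdm W_factor_eq vdm_def shifted_def flip: prod.distrib)
qed

text \<open>Undoing the last insertion at a corner determines the previous tableau and the last letter, so
  the fiber sizes satisfy the same recursion over corners as \<open>std_count\<close>.\<close>

lemma card_rsk_fiber:
  assumes "T \<in> ssyts M l" "l \<in> Omega_sum M N"
  shows "real (card {w \<in> words M N. fst (rsk N w) = T}) = std_count M l"
  using assms
proof (induction N arbitrary: T l)
  case 0
  then have "l = (\<lambda>_. 0)" by (auto simp: Omega_sum_def Omega_def fun_eq_iff)
  moreover have "T = []"
    using 0 calculation by (cases T) (auto simp: ssyts_def dest: fun_cong[of _ _ 1])
  ultimately show ?case by (simp add: words_def std_count_0)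
next
  case (Suc N)
  define C where "C = {i. l (Suc (Suc i)) < l (Suc i)}"
  have T: "ssyt T" "set (concat T) \<subseteq> {1..M}" "tableau_shape T = l" using Suc.prems by (auto simp: ssyts_def)
  have l: "l \<in> Omega M" "(\<Sum>j=1..M. l j) = Suc N" using Suc.prems by (auto simp: Omega_sum_def)
  have "\<forall>i\<in>C. \<exists>S x. ssyt S \<and> tableau_insert S x = (T, i)"
    using tableau_insert_surj[OF T(1)] T(3) by (auto simp: C_def)
  \<comment> \<open>For each corner \<open>i\<close>, the tableau and the letter obtained by undoing
    an insertion that ended in this row.\<close>
  then obtain S x where S: "ssyt (S i)" "tableau_insert (S i) (x i) = (T, i)" if "i \<in> C" for i
    by metis
  have SM: "set (concat (S i)) \<subseteq> {1..M}" "x i \<in> {1..M}" "length (concat (S i)) = N" if "i \<in> C" for i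
  proof -
    have *: "mset (concat T) = mset (concat (S i)) + {#x i#}"
      using mset_tableau_insert[OF S(1)[OF that], of "x i"] S(2)[OF that] by simp
    show "set (concat (S i)) \<subseteq> {1..M}" "x i \<in> {1..M}"
      using arg_cong[OF *, of set_mset] T(2) by auto
    have "length (concat T) = Suc N"
      using ssyt_shape_Omega[OF T(1,2)] T(3) l by (simp add: Omega_sum_def)
    then show "length (concat (S i)) = N"
      using arg_cong[OF *, of size] by simp
  qed
  have shape: "tableau_shape (S i) = l(Suc i := l (Suc i) - 1)" if "i \<in> C" for i
    using tableau_shape_insert[OF S(2)[OF that]] T(3) by auto
  have IH: "real (card {w \<in> words M N. fst (rsk N w) = S i}) = std_count M (l(Suc i := l (Suc i) - 1))"
    if "i \<in> C" for i
    unfolding shape[OF that, symmetric]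
  proof (rule Suc.IH)
    show "S i \<in> ssyts M (tableau_shape (S i))" using S SM that by (auto simp: ssyts_def)
    show "tableau_shape (S i) \<in> Omega_sum M N"
      using ssyt_shape_Omega[OF S(1)[OF that] SM(1)[OF that]] SM(3)[OF that] by simp
  qed
  define ext where "ext i = (\<lambda>w. w(Suc N := x i))" for i
  have rsk_ext: "rsk N (w(Suc N := y)) = rsk N w" for w y
    by (rule rsk_cong) auto
  \<comment> \<open>Words are classified by the row in which their last insertion ended; injectivity
    forces the previous tableau and the last letter to be \<open>S i\<close> and
    \<open>x i\<close>.\<close>
  have "{w \<in> words M (Suc N). fst (rsk (Suc N) w) = T} = (\<Union>i\<in>C. ext i ` {w \<in> words M N. fst (rsk N w) = S i})"
  proof (intro equalityI subsetI)
    fix v assume "v \<in> {w \<in> words M (Suc N). fst (rsk (Suc N) w) = T}"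
    then obtain w y where w: "w \<in> words M N" "v = w(Suc N := y)" "fst (rsk (Suc N) v) = T"
      by (auto simp: words_Suc)
    obtain i where i: "tableau_insert (fst (rsk N w)) y = (T, i)"
      using w(3) unfolding fst_rsk_Suc w(2) rsk_ext by (metis fun_upd_same prod.collapse)
    have ss: "ssyt (fst (rsk N w))" using rsk_ssyt[OF w(1)] by simp
    have "i \<in> C" using tableau_insert_corner[OF ss i] T(3) by (simp add: C_def)
    moreover have "fst (rsk N w) = S i \<and> y = x i"
      using tableau_insert_inject[OF ss S(1) i S(2)] calculation by simp
    ultimately show "v \<in> (\<Union>i\<in>C. ext i ` {w \<in> words M N. fst (rsk N w) = S i})"
      using w by (auto simp: ext_def)
  next
    fix v assume "v \<in> (\<Union>i\<in>C. ext i ` {w \<in> words M N. fst (rsk N w) = S i})"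
    then obtain i w where w: "i \<in> C" "w \<in> words M N" "fst (rsk N w) = S i" "v = w(Suc N := x i)"
      by (auto simp: ext_def)
    have "fst (rsk (Suc N) v) = T"
      unfolding fst_rsk_Suc w(4) rsk_ext using w S(2)[OF w(1)] by simp
    moreover have "v \<in> words M (Suc N)" using w SM(2)[OF w(1)] by (auto simp: words_Suc)
    ultimately show "v \<in> {w \<in> words M (Suc N). fst (rsk (Suc N) w) = T}" by simp
  qed
  moreover have "finite C"
  proof (rule finite_subset)
    show "C \<subseteq> {..<M}" using Omega_eq_0[OF l(1)] by (auto simp: C_def) (metis less_Suc_eq_le not_less not_less0)
  qed simp
  moreover have "ext i ` {w \<in> words M N. fst (rsk N w) = S i} \<inter> ext j ` {w \<in> words M N. fst (rsk N w) = S j} = {}"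
    if "i \<in> C" "j \<in> C" "i \<noteq> j" for i j
  proof -
    \<comment> \<open>The final row of the last insertion is determined by the word, so different
      corners give disjoint sets.\<close>
    have row: "snd (tableau_insert (fst (rsk N v)) (v (Suc N))) = k"
      if "v \<in> ext k ` {w \<in> words M N. fst (rsk N w) = S k}" "k \<in> C" for v k
      using that S(2)[of k] by (auto simp: ext_def rsk_ext)
    show ?thesis
    proof (rule equals0I)
      fix v assume "v \<in> ext i ` {w \<in> words M N. fst (rsk N w) = S i} \<inter> ext j ` {w \<in> words M N. fst (rsk N w) = S j}"
      from row[OF IntD1[OF this] that(1)] row[OF IntD2[OF this] that(2)] that(3)
      show False by simp
    qed
  qed
  moreover have "card (ext i ` {w \<in> words M N. fst (rsk N w) = S i}) = card {w \<in> words M N. fst (rsk N w) = S i}" for i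
  proof (rule card_image, rule inj_onI)
    fix v w assume vw: "v \<in> {w \<in> words M N. fst (rsk N w) = S i}" "w \<in> {w \<in> words M N. fst (rsk N w) = S i}" "ext i v = ext i w"
    \<comment> \<open>A word of length \<open>N\<close> has a fixed value at \<open>Suc N\<close>,
      so overwriting that value loses no information.\<close>
    have undef: "u (Suc N) = undefined" if "u \<in> words M N" for u
      using that PiE_arb[of u "{1..N}" "\<lambda>_. {1..M}" "Suc N"] by (simp add: words_def)
    show "v = w"
    proof
      fix k
      show "v k = w k"
        using vw(1,2) undef[of v] undef[of w] fun_cong[OF vw(3), of k] by (cases "k = Suc N") (auto simp: ext_def)
    qed
  qed
  ultimately have "card {w \<in> words M (Suc N). fst (rsk (Suc N) w) = T} = (\<Sum>i\<in>C. card {w \<in> words M N. fst (rsk N w) = S i})"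
    by (simp add: card_UN_disjoint)
  then have "real (card {w \<in> words M (Suc N). fst (rsk (Suc N) w) = T}) = (\<Sum>i\<in>C. std_count M (l(Suc i := l (Suc i) - 1)))"
    using IH by simp
  then show ?case using sum_std_count_remove_corner[OF l] by (simp add: C_def)
qed

section \<open>Longest increasing subsequences\<close>

text \<open>The bound \<open>a\<close> on the values makes an induction on \<open>N\<close>
  possible: when a subsequence is extended by a new letter, that letter becomes the bound for the
  part before it.\<close>

definition has_incr :: "nat \<Rightarrow> (nat \<Rightarrow> nat) \<Rightarrow> nat \<Rightarrow> nat \<Rightarrow> bool" where
  "has_incr N w a m \<longleftrightarrow> (\<exists>i. strict_mono_on {1..m} i \<and> i ` {1..m} \<subseteq> {1..N} \<and>
     mono_on {1..m} (\<lambda>j. w (i j)) \<and> (\<forall>j\<in>{1..m}. w (i j) \<le> a))"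

lemma has_incr_Suc:
  "has_incr (Suc N) w a m \<longleftrightarrow> has_incr N w a m \<or>
     (\<exists>m'. m = Suc m' \<and> w (Suc N) \<le> a \<and> has_incr N w (w (Suc N)) m')"
proof
  assume "has_incr (Suc N) w a m"
  then obtain i where i: "strict_mono_on {1..m} i" "i ` {1..m} \<subseteq> {1..Suc N}"
     "mono_on {1..m} (\<lambda>j. w (i j))" "\<forall>j\<in>{1..m}. w (i j) \<le> a"
    by (auto simp: has_incr_def)
  show "has_incr N w a m \<or> (\<exists>m'. m = Suc m' \<and> w (Suc N) \<le> a \<and> has_incr N w (w (Suc N)) m')"
  proof (cases "Suc N \<in> i ` {1..m}")
    case False
    then have "i ` {1..m} \<subseteq> {1..Suc N} - {Suc N}" using i(2) by blast
    then have "i ` {1..m} \<subseteq> {1..N}" by (simp add: atLeastAtMostSuc_conv)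
    then show ?thesis using i by (auto simp: has_incr_def)
  next
    case True
    then obtain j where j: "j \<in> {1..m}" "i j = Suc N" by auto
    have "m \<in> {1..m}" using j by simp
    then have "i m \<le> Suc N" using i(2) by (metis atLeastAtMost_iff image_subset_iff)
    \<comment> \<open>Positions increase strictly, so the largest position \<open>Suc N\<close> can
      only be the last one chosen.\<close>
    then have "\<not> j < m" using strict_mono_onD[OF i(1), of j m] j \<open>m \<in> {1..m}\<close> by fastforce
    then have jm: "j = m" using j by simp
    obtain m' where m': "m = Suc m'" using j by (cases m) auto
    have lt: "i k < Suc N" if "k \<in> {1..m'}" for k
      using strict_mono_onD[OF i(1), of k m] that j jm m' by auto
    have "strict_mono_on {1..m'} i" "mono_on {1..m'} (\<lambda>j. w (i j))"
      using i(1,3) by (auto simp: monotone_on_def m')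
    moreover have "i ` {1..m'} \<subseteq> {1..N}"
      using lt i(2) by (fastforce simp: m')
    moreover have "\<forall>k\<in>{1..m'}. w (i k) \<le> w (Suc N)"
      using mono_onD[OF i(3), of _ m] j jm m' by auto
    ultimately have "has_incr N w (w (Suc N)) m'" by (auto simp: has_incr_def)
    moreover have "w (Suc N) \<le> a" using i(4) j by metis
    ultimately show ?thesis using m' by blast
  qed
next
  assume "has_incr N w a m \<or> (\<exists>m'. m = Suc m' \<and> w (Suc N) \<le> a \<and> has_incr N w (w (Suc N)) m')"
  then show "has_incr (Suc N) w a m"
  proof
    assume "has_incr N w a m"
    moreover have "{1..N} \<subseteq> {1..Suc N}" by auto
    ultimately show ?thesis unfolding has_incr_def by (blast dest: subset_trans)
  next
    assume "\<exists>m'. m = Suc m' \<and> w (Suc N) \<le> a \<and> has_incr N w (w (Suc N)) m'"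
    then obtain m' i where m: "m = Suc m'" "w (Suc N) \<le> a" and i: "strict_mono_on {1..m'} i" "i ` {1..m'} \<subseteq> {1..N}"
     "mono_on {1..m'} (\<lambda>j. w (i j))" "\<forall>j\<in>{1..m'}. w (i j) \<le> w (Suc N)"
      by (auto simp: has_incr_def)
    have le: "i j \<le> N" if "1 \<le> j" "j \<le> m'" for j
      using i(2) that by (auto simp: image_subset_iff)
    have "strict_mono_on {1..m} (i(m := Suc N))"
    proof (rule strict_mono_onI)
      fix j k assume "j \<in> {1..m}" "k \<in> {1..m}" "j < k"
      then show "(i(m := Suc N)) j < (i(m := Suc N)) k"
        using strict_mono_onD[OF i(1), of j k] le[of j] by (cases "k = m") (auto simp: m)
    qed
    moreover have "(i(m := Suc N)) ` {1..m} \<subseteq> {1..Suc N}"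
      using i(2) by (auto simp: m image_subset_iff le_Suc_eq)
    moreover have "mono_on {1..m} (\<lambda>j. w ((i(m := Suc N)) j))"
    proof (rule mono_onI)
      fix j k assume "j \<in> {1..m}" "k \<in> {1..m}" "j \<le> k"
      then show "w ((i(m := Suc N)) j) \<le> w ((i(m := Suc N)) k)"
        using mono_onD[OF i(3), of j k] i(4) by (cases "k = m"; cases "j = m") (auto simp: m)
    qed
    moreover have "\<forall>j\<in>{1..m}. w ((i(m := Suc N)) j) \<le> a"
    proof
      fix j assume "j \<in> {1..m}"
      then show "w ((i(m := Suc N)) j) \<le> a"
        using i(4) m(2) by (cases "j = m") (auto simp: m intro: order.trans[of _ "w (Suc N)" a])
    qed
    ultimately show ?thesis unfolding has_incr_def by blast
  qed
qed

lemma ssyt_rsk: "ssyt (fst (rsk N w))"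
  by (induction N) (simp_all only: fst_rsk_Suc ssyt_tableau_insert, simp)

text \<open>Schensted's theorem, refined by the value bound: \<open>has_incr_Suc\<close> and
  \<open>count_le_row_insert\<close> are the same recursion, a disjunction on one side and a maximum
  on the other.\<close>

lemma has_incr_iff: "has_incr N w a m \<longleftrightarrow> m \<le> count_le (first_row (fst (rsk N w))) a"
proof (induction N arbitrary: a m)
  case 0
  then show ?case by (auto simp: has_incr_def monotone_on_def)
next
  case (Suc N)
  show ?case
    unfolding has_incr_Suc Suc.IH fst_rsk_Suc first_row_tableau_insert
      count_le_row_insert[OF sorted_first_row[OF ssyt_rsk]]
    by (cases m) (simp_all add: le_max_iff_disj)
qed

text \<open>All letters are at most \<open>M\<close>, so the bound \<open>a = M\<close> admits every
  subsequence and counts the whole first row. By \<open>has_incr_iff\<close> the possible lengths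
  form an initial segment.\<close>

lemma longest_increasing_eq_shape:
  assumes "w \<in> words M N"
  shows "longest_increasing N w = rsk_shape N w 1"
proof -
  define R where "R = first_row (fst (rsk N w))"
  have "set R \<subseteq> {1..M}"
    using rsk_ssyt[OF assms] unfolding R_def by (cases "fst (rsk N w)") auto
  then have "count_le R M = length R" by (subst filter_True) auto
  moreover have "w j \<le> M" if "j \<in> {1..N}" for j using assms that by (auto simp: words_def)
  then have "\<forall>j\<in>{1..m}. w (i j) \<le> M" if "i ` {1..m} \<subseteq> {1..N}" for i :: "nat \<Rightarrow> nat" and m
    using that by (metis image_subset_iff)
  then have "{m. \<exists>i. strict_mono_on {1..m} i \<and> i ` {1..m} \<subseteq> {1..N} \<and> mono_on {1..m} (\<lambda>j. w (i j))}
      = {m. has_incr N w M m}"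
    unfolding has_incr_def by blast
  moreover have "{m. has_incr N w M m} = {..count_le R M}"
    by (auto simp: has_incr_iff R_def)
  ultimately have "longest_increasing N w = Max {..length R}"
    unfolding longest_increasing_def by simp
  also have "\<dots> = length R" by (rule Max_eqI) auto
  finally show ?thesis by (simp add: rsk_shape_def tableau_shape_first_row R_def)
qed

section \<open>Counting semistandard tableaux\<close>

definition tab_rows :: "nat list list \<Rightarrow> nat \<Rightarrow> nat list" where
  "tab_rows T i = (if 1 \<le> i \<and> i \<le> length T then T ! (i - 1) else [])"

lemma tab_rows_Nil [simp]: "tab_rows [] = (\<lambda>_. [])"
  by (auto simp: tab_rows_def)

lemma tab_rows_0 [simp]: "tab_rows T 0 = []"
  by (auto simp: tab_rows_def)

lemma tab_rows_Cons [simp]: "tab_rows (r # T) (Suc k) = (if k = 0 then r else tab_rows T k)"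
  by (cases k) (auto simp: tab_rows_def)

lemma tab_rows_1: "tab_rows T (Suc 0) = first_row T"
  by (cases T) auto

lemma length_tab_rows: "length (tab_rows T i) = tableau_shape T i"
  by (auto simp: tab_rows_def tableau_shape_def)

lemma set_tab_rows: "set (tab_rows T i) \<subseteq> set (concat T)"
  by (auto simp: tab_rows_def intro!: bexI[of _ "T ! (i - 1)"])

lemma set_concat_tab_rows: "set (concat T) = (\<Union>i. set (tab_rows T i))"
proof
  show "set (concat T) \<subseteq> (\<Union>i. set (tab_rows T i))"
  proof
    fix e assume "e \<in> set (concat T)"
    then obtain k where "k < length T" "e \<in> set (T ! k)" by (auto simp: in_set_conv_nth[of _ T])
    then have "e \<in> set (tab_rows T (Suc k))" by (simp add: tab_rows_def)
    then show "e \<in> (\<Union>i. set (tab_rows T i))" by blast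
  qed
qed (use set_tab_rows in blast)

lemma ssyt_tab_rows:
  "ssyt T \<Longrightarrow> sorted (tab_rows T i) \<and> (1 \<le> i \<longrightarrow> row_above (tab_rows T i) (tab_rows T (Suc i)))"
proof (induction T arbitrary: i)
  case (Cons r T)
  show ?case
  proof (cases i)
    case (Suc j)
    then show ?thesis using Cons by (cases j) (auto simp: tab_rows_1)
  qed simp
qed simp

text \<open>Rows of a semistandard tableau are nonempty, so they cannot be confused with the
  padding.\<close>

lemma tab_rows_inject: "ssyt S \<Longrightarrow> ssyt T \<Longrightarrow> tab_rows S = tab_rows T \<Longrightarrow> S = T"
proof (induction S arbitrary: T)
  case Nil
  have "first_row T = []" unfolding tab_rows_1[symmetric] Nil.prems(3)[symmetric] by simp
  then show ?case using Nil.prems(2) by (cases T) auto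
next
  case (Cons r S)
  obtain q U where T: "T = q # U"
  proof (cases T)
    case Nil
    have "first_row T = r" unfolding tab_rows_1[symmetric] Cons.prems(3)[symmetric] by simp
    then show thesis using Nil Cons.prems(1) by simp
  qed
  have "tab_rows S k = tab_rows U k" for k
    using fun_cong[OF Cons.prems(3), of "Suc k"] by (cases k) (auto simp: T)
  then have "S = U" using Cons T by auto
  then show ?case using fun_cong[OF Cons.prems(3), of "Suc 0"] by (simp add: T)
qed

text \<open>Row lengths decrease weakly from row 1 on, so all rows after the first empty one are
  empty and form the padding. The bound \<open>K\<close> makes peeling off the first row
  terminate.\<close>

lemma tab_rows_surj:
  assumes "\<And>i. sorted (\<rho> i)" "\<And>i. 1 \<le> i \<Longrightarrow> row_above (\<rho> i) (\<rho> (Suc i))" "\<rho> 0 = []" "\<And>i. i > K \<Longrightarrow> \<rho> i = []"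
  shows "\<exists>T. ssyt T \<and> tab_rows T = \<rho>"
  using assms
proof (induction K arbitrary: \<rho>)
  case 0
  then have "\<rho> = (\<lambda>_. [])" by (auto simp: fun_eq_iff) (metis gr0I)
  then show ?case by (intro exI[of _ "[]"]) simp
next
  case (Suc K)
  show ?case
  proof (cases "\<rho> 1 = []")
    case True
    have "\<rho> i = []" if "1 \<le> i" for i
      using that True
    proof (induction rule: dec_induct)
      case (step k)
      then show ?case using row_above_length[OF Suc.prems(2)[of k]] by simp
    qed
    then have "\<rho> = (\<lambda>_. [])" using Suc.prems(3) by (metis One_nat_def Suc_leI gr0I)
    then show ?thesis by (intro exI[of _ "[]"]) simp
  next
    case False
    define \<rho>' where "\<rho>' k = (if k = 0 then [] else \<rho> (Suc k))" for k
    have "\<exists>T. ssyt T \<and> tab_rows T = \<rho>'"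
      using Suc.prems by (intro Suc.IH) (auto simp: \<rho>'_def)
    then obtain T where T: "ssyt T" "tab_rows T = \<rho>'" by blast
    have "first_row T = \<rho> (Suc 1)" using T(2) tab_rows_1[of T] by (simp add: \<rho>'_def)
    then have "ssyt (\<rho> 1 # T)" using T(1) Suc.prems(1) Suc.prems(2)[of 1] False by simp
    moreover have "tab_rows (\<rho> 1 # T) k = \<rho> k" for k
      using T(2) Suc.prems(3) by (cases k) (auto simp: \<rho>'_def)
    ultimately show ?thesis by blast
  qed
qed

text \<open>Semistandard tableaux as 1-based families of rows, padded with empty rows, so that letters can
  be removed row by row.\<close>

definition row_families :: "nat \<Rightarrow> (nat \<Rightarrow> nat) \<Rightarrow> (nat \<Rightarrow> nat list) set" where
  "row_families M l = {\<rho>. (\<forall>i. sorted (\<rho> i) \<and> set (\<rho> i) \<subseteq> {1..M} \<and> length (\<rho> i) = l i) \<and>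
     (\<forall>i\<ge>1. row_above (\<rho> i) (\<rho> (Suc i)))}"

lemma bij_betw_tab_rows:
  assumes "l \<in> Omega M"
  shows "bij_betw tab_rows (ssyts M l) (row_families M l)"
proof (rule bij_betw_imageI)
  show "inj_on tab_rows (ssyts M l)"
    by (rule inj_onI) (auto simp: ssyts_def intro: tab_rows_inject)
  show "tab_rows ` ssyts M l = row_families M l"
  proof (intro equalityI subsetI)
    fix \<rho> assume "\<rho> \<in> tab_rows ` ssyts M l"
    then obtain T where T: "T \<in> ssyts M l" "\<rho> = tab_rows T" by blast
    then show "\<rho> \<in> row_families M l"
      using ssyt_tab_rows[of T] set_tab_rows[of T] unfolding row_families_def ssyts_def
      by (simp add: length_tab_rows) blast
  next
    fix \<rho> assume \<rho>: "\<rho> \<in> row_families M l"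
    have "\<rho> i = []" if "i \<notin> {1..M}" for i
    proof -
      have "l i = 0" using that assms by (auto simp: Omega_def)
      moreover have "length (\<rho> i) = l i" using \<rho> by (simp add: row_families_def)
      ultimately show ?thesis by simp
    qed
    then have "\<exists>T. ssyt T \<and> tab_rows T = \<rho>"
      using \<rho> by (intro tab_rows_surj[of \<rho> M]) (auto simp: row_families_def)
    then obtain T where T: "ssyt T" "tab_rows T = \<rho>" by blast
    moreover have "set (concat T) \<subseteq> {1..M}"
      unfolding set_concat_tab_rows T(2) using \<rho> by (auto simp: row_families_def)
    moreover have "tableau_shape T = l"
      using \<rho> by (auto simp: T(2)[symmetric] row_families_def length_tab_rows)
    ultimately show "\<rho> \<in> tab_rows ` ssyts M l" by (auto simp: ssyts_def)
  qed
qed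

section \<open>Removing the largest letter and the branching of shapes\<close>

lemma row_families_entry_ge:
  assumes "\<rho> \<in> row_families M l" "1 \<le> i"
  shows "\<forall>e\<in>set (\<rho> i). i \<le> e"
  using assms(2)
proof (induction rule: dec_induct)
  case base
  have "set (\<rho> 1) \<subseteq> {1..M}" using assms(1) by (simp add: row_families_def)
  then show ?case by auto
next
  case (step k)
  then have "count_lt (\<rho> k) k = 0" by (auto simp: filter_empty_conv not_less)
  moreover have "count_le (\<rho> (Suc k)) k \<le> count_lt (\<rho> k) k"
    using assms(1) step(1) by (auto simp: row_families_def row_above_def)
  ultimately show ?case by (auto simp: filter_empty_conv not_le)
qed

text \<open>For \<open>l\<close> in \<open>Omega (Suc n)\<close>, these are the shapes that can
  remain when all letters \<open>Suc n\<close> are removed: the removed boxes form a horizontal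
  strip.\<close>

definition interlacing :: "nat \<Rightarrow> (nat \<Rightarrow> nat) \<Rightarrow> (nat \<Rightarrow> nat) set" where
  "interlacing n l = {m. (\<forall>i\<in>{1..n}. l (Suc i) \<le> m i \<and> m i \<le> l i) \<and> (\<forall>i. i \<notin> {1..n} \<longrightarrow> m i = 0)}"

lemma interlacing_Omega:
  assumes "l \<in> Omega (Suc n)" "m \<in> interlacing n l"
  shows "m \<in> Omega n"
proof -
  have "m j \<le> m i" if "1 \<le> i" "i \<le> j" "j \<le> n" for i j
  proof (cases "i = j")
    case False
    then have "l j \<le> l (Suc i)" using that by (intro Omega_antimono[OF assms(1)]) auto
    moreover have "m j \<le> l j" "l (Suc i) \<le> m i" using assms(2) that by (auto simp: interlacing_def)
    ultimately show ?thesis by simp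
  qed simp
  then show ?thesis using assms(2) by (auto simp: Omega_def interlacing_def monotone_on_def)
qed

text \<open>The largest letters fill the end of a sorted row, so the row is determined by its
  smaller letters and its length.\<close>

lemma sorted_split_max:
  "sorted r \<Longrightarrow> set r \<subseteq> {..Suc n} \<Longrightarrow>
   r = filter (\<lambda>e. e \<le> n) r @ replicate (length r - length (filter (\<lambda>e. e \<le> n) r)) (Suc n)"
proof (induction r)
  case (Cons e r)
  show ?case
  proof (cases "e \<le> n")
    case False
    then have e: "e = Suc n" using Cons.prems by simp
    then have "\<forall>f\<in>set r. f = Suc n" using Cons.prems by (auto intro!: le_antisym)
    then have "filter (\<lambda>e. e \<le> n) r = []" "r = replicate (length r) (Suc n)"
      by (auto simp: filter_empty_conv replicate_length_same)
    then show ?thesis using e by simp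
  qed (use Cons in auto)
qed simp

lemma filter_row_families:
  assumes "l \<in> Omega (Suc n)" "\<rho> \<in> row_families (Suc n) l"
  shows "(\<lambda>i. length (filter (\<lambda>e. e \<le> n) (\<rho> i))) \<in> interlacing n l"
    and "(\<lambda>i. filter (\<lambda>e. e \<le> n) (\<rho> i)) \<in> row_families n (\<lambda>i. length (filter (\<lambda>e. e \<le> n) (\<rho> i)))"
proof -
  have \<rho>: "sorted (\<rho> i)" "set (\<rho> i) \<subseteq> {1..Suc n}" "length (\<rho> i) = l i" for i
    using assms(2) by (auto simp: row_families_def)
  have above: "count_le (\<rho> (Suc i)) a \<le> count_lt (\<rho> i) a" if "1 \<le> i" for i a
    using assms(2) that by (auto simp: row_families_def row_above_def)
  \<comment> \<open>Every box of row \<open>Suc i\<close> has a strictly smaller entry above it,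
    hence an entry at most \<open>n\<close>.\<close>
  have "l (Suc i) \<le> count_le (\<rho> i) n" if "1 \<le> i" for i
  proof -
    have "l (Suc i) = count_le (\<rho> (Suc i)) (Suc n)"
      using \<rho>(2)[of "Suc i"] by (subst filter_True) (auto simp: \<rho>(3))
    then show ?thesis using above[OF that, of "Suc n"] by (simp add: less_Suc_eq_le)
  qed
  moreover have "count_le (\<rho> i) n \<le> l i" for i
    using length_filter_le[of _ "\<rho> i"] \<rho>(3)[of i] by metis
  moreover have "count_le (\<rho> i) n = 0" if "i \<notin> {1..n}" for i
  proof (cases "i = 0")
    case True
    then show ?thesis using \<rho>(3)[of 0] assms(1) by (simp add: Omega_def)
  next
    case False
    then show ?thesis using row_families_entry_ge[OF assms(2), of i] that
      by (fastforce simp: filter_empty_conv)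
  qed
  ultimately show "(\<lambda>i. count_le (\<rho> i) n) \<in> interlacing n l"
    by (auto simp: interlacing_def)
  have "row_above (filter (\<lambda>e. e \<le> n) (\<rho> i)) (filter (\<lambda>e. e \<le> n) (\<rho> (Suc i)))" if "1 \<le> i" for i
    unfolding row_above_def
  proof
    fix a
    \<comment> \<open>Filtering cuts the threshold \<open>a\<close> off at \<open>n\<close>, which
      reduces the claim to the unfiltered rows.\<close>
    have "count_le (filter (\<lambda>e. e \<le> n) (\<rho> (Suc i))) a = count_le (\<rho> (Suc i)) (min n a)"
      by simp
    also have "\<dots> \<le> count_lt (\<rho> i) (min n a)" using above[OF that] .
    also have "\<dots> \<le> count_lt (\<rho> i) (min (Suc n) a)" by (rule count_lt_mono) auto
    also have "\<dots> = count_lt (filter (\<lambda>e. e \<le> n) (\<rho> i)) a"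
      by (simp add: less_Suc_eq_le)
    finally show "count_le (filter (\<lambda>e. e \<le> n) (\<rho> (Suc i))) a \<le> count_lt (filter (\<lambda>e. e \<le> n) (\<rho> i)) a" .
  qed
  then show "(\<lambda>i. filter (\<lambda>e. e \<le> n) (\<rho> i)) \<in> row_families n (\<lambda>i. count_le (\<rho> i) n)"
    using \<rho> sorted_filter[of "\<lambda>e. e"] by (fastforce simp: row_families_def)
qed

text \<open>For thresholds up to \<open>n\<close> the new letters are not counted. Beyond
  \<open>n\<close>, interlacing gives \<open>l (Suc i) \<le> m i\<close>, so the old letters of row
  \<open>i\<close> already cover all of row \<open>Suc i\<close>.\<close>

lemma extend_row_families:
  assumes "l \<in> Omega (Suc n)" "m \<in> interlacing n l" "\<rho> \<in> row_families n m"
  shows "(\<lambda>i. \<rho> i @ replicate (l i - m i) (Suc n)) \<in> row_families (Suc n) l"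
proof -
  define \<sigma> where "\<sigma> i = \<rho> i @ replicate (l i - m i) (Suc n)" for i
  have \<rho>: "sorted (\<rho> i)" "set (\<rho> i) \<subseteq> {1..n}" "length (\<rho> i) = m i" for i
    using assms(3) by (auto simp: row_families_def)
  have above: "count_le (\<rho> (Suc i)) a \<le> count_lt (\<rho> i) a" if "1 \<le> i" for i a
    using assms(3) that by (auto simp: row_families_def row_above_def)
  have "m i \<le> l i" for i using assms(2) by (cases "i \<in> {1..n}") (auto simp: interlacing_def)
  then have len: "length (\<sigma> i) = l i" for i by (simp add: \<sigma>_def \<rho>(3))
  have "sorted (\<sigma> i)" for i
    using \<rho>(1,2)[of i] by (auto simp: \<sigma>_def sorted_append intro: le_SucI)
  moreover have "set (\<sigma> i) \<subseteq> {1..Suc n}" for i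
    using \<rho>(2)[of i] by (fastforce simp: \<sigma>_def)
  moreover have "row_above (\<sigma> i) (\<sigma> (Suc i))" if "1 \<le> i" for i
    unfolding row_above_def
  proof
    fix a
    show "count_le (\<sigma> (Suc i)) a \<le> count_lt (\<sigma> i) a"
    proof (cases "a \<le> n")
      case True
      then show ?thesis using above[OF that, of a] by (simp add: \<sigma>_def)
    next
      case False
      have "count_le (\<sigma> (Suc i)) a \<le> l (Suc i)" by (metis length_filter_le len)
      also have "\<dots> \<le> m i"
        using assms(1,2) that by (cases "i \<le> n") (auto simp: interlacing_def Omega_eq_0)
      also have "m i = count_lt (\<rho> i) a"
        using \<rho>(2)[of i] False by (subst filter_True) (auto simp: \<rho>(3))
      also have "\<dots> \<le> count_lt (\<sigma> i) a" by (simp add: \<sigma>_def)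
      finally show ?thesis .
    qed
  qed
  ultimately have "\<sigma> \<in> row_families (Suc n) l" using len by (simp add: row_families_def)
  then show ?thesis by (simp add: \<sigma>_def[abs_def])
qed

lemma bij_betw_restrict_rows:
  assumes "l \<in> Omega (Suc n)"
  shows "bij_betw (\<lambda>\<rho> i. filter (\<lambda>e. e \<le> n) (\<rho> i)) (row_families (Suc n) l)
           (\<Union>m\<in>interlacing n l. row_families n m)"
proof (rule bij_betw_byWitness[where f' = "\<lambda>\<rho> i. \<rho> i @ replicate (l i - length (\<rho> i)) (Suc n)"])
  show "\<forall>\<rho>\<in>row_families (Suc n) l. (\<lambda>i. filter (\<lambda>e. e \<le> n) (\<rho> i) @
     replicate (l i - length (filter (\<lambda>e. e \<le> n) (\<rho> i))) (Suc n)) = \<rho>"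
  proof (intro ballI ext)
    fix \<rho> i assume "\<rho> \<in> row_families (Suc n) l"
    then have "sorted (\<rho> i)" "set (\<rho> i) \<subseteq> {1..Suc n}" "length (\<rho> i) = l i"
      by (simp_all add: row_families_def)
    moreover have "{1..Suc n} \<subseteq> {..Suc n}" by auto
    ultimately have "sorted (\<rho> i)" "set (\<rho> i) \<subseteq> {..Suc n}" "length (\<rho> i) = l i"
      by auto
    then show "filter (\<lambda>e. e \<le> n) (\<rho> i) @ replicate (l i - length (filter (\<lambda>e. e \<le> n) (\<rho> i))) (Suc n) = \<rho> i"
      using sorted_split_max[of "\<rho> i" n] by simp
  qed
  show "\<forall>\<rho>\<in>\<Union>m\<in>interlacing n l. row_families n m.
     (\<lambda>i. filter (\<lambda>e. e \<le> n) (\<rho> i @ replicate (l i - length (\<rho> i)) (Suc n))) = \<rho>"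
  proof (intro ballI ext)
    fix \<rho> i assume "\<rho> \<in> (\<Union>m\<in>interlacing n l. row_families n m)"
    then have "\<forall>e\<in>set (\<rho> i). e \<le> n" by (auto simp: row_families_def subset_iff)
    then show "filter (\<lambda>e. e \<le> n) (\<rho> i @ replicate (l i - length (\<rho> i)) (Suc n)) = \<rho> i"
      by (simp add: filter_id_conv)
  qed
  show "(\<lambda>\<rho> i. filter (\<lambda>e. e \<le> n) (\<rho> i)) ` row_families (Suc n) l \<subseteq> (\<Union>m\<in>interlacing n l. row_families n m)"
    using filter_row_families[OF assms] by blast
  show "(\<lambda>\<rho> i. \<rho> i @ replicate (l i - length (\<rho> i)) (Suc n)) ` (\<Union>m\<in>interlacing n l. row_families n m)
     \<subseteq> row_families (Suc n) l"
  proof clarify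
    fix m \<rho> assume m: "m \<in> interlacing n l" "\<rho> \<in> row_families n m"
    then have "length (\<rho> i) = m i" for i by (simp add: row_families_def)
    then show "(\<lambda>i. \<rho> i @ replicate (l i - length (\<rho> i)) (Suc n)) \<in> row_families (Suc n) l"
      using extend_row_families[OF assms m] by simp
  qed
qed

text \<open>The staircase for \<open>n\<close> is one step shorter than that for
  \<open>Suc n\<close>, which turns the weak inequalities of interlacing into half-open intervals.
  In the inverse map the natural subtraction is exact, since every \<open>y i\<close> in range is at
  least \<open>i\<close>.\<close>

lemma sum_interlacing:
  fixes f :: "nat \<Rightarrow> (nat \<Rightarrow> real) \<Rightarrow> real"
  assumes "l \<in> Omega (Suc n)"
  shows "(\<Sum>m\<in>interlacing n l. vdm n (\<lambda>i. real (shifted n m i)))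
    = (\<Sum>y\<in>(\<Pi>\<^sub>E i\<in>{..<n}. {shifted (Suc n) l i..<shifted (Suc n) l (Suc i)}). vdm n (\<lambda>i. real (y i)))"
proof (rule sum.reindex_bij_witness[where j = "\<lambda>m. restrict (shifted n m) {..<n}" and
      i = "\<lambda>y k. if k \<in> {1..n} then y (n - k) - (n - k) else 0"])
  fix m assume m: "m \<in> interlacing n l"
  show "(\<lambda>k. if k \<in> {1..n} then restrict (shifted n m) {..<n} (n - k) - (n - k) else 0) = m"
    using m by (auto simp: fun_eq_iff shifted_def interlacing_def)
  show "restrict (shifted n m) {..<n} \<in> (\<Pi>\<^sub>E i\<in>{..<n}. {shifted (Suc n) l i..<shifted (Suc n) l (Suc i)})"
    using m by (auto simp: shifted_def interlacing_def Suc_diff_le less_Suc_eq_le)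
  show "vdm n (\<lambda>i. real (restrict (shifted n m) {..<n} i)) = vdm n (\<lambda>i. real (shifted n m i))"
    by (rule vdm_cong) simp
next
  fix y assume y: "y \<in> (\<Pi>\<^sub>E i\<in>{..<n}. {shifted (Suc n) l i..<shifted (Suc n) l (Suc i)})"
  have b: "l (Suc (n - i)) + i \<le> y i \<and> y i \<le> l (n - i) + i" if "i < n" for i
    using PiE_mem[OF y, of i] that by (auto simp: shifted_def Suc_diff_le)
  show "restrict (shifted n (\<lambda>k. if k \<in> {1..n} then y (n - k) - (n - k) else 0)) {..<n} = y"
  proof
    fix i
    show "restrict (shifted n (\<lambda>k. if k \<in> {1..n} then y (n - k) - (n - k) else 0)) {..<n} i = y i"
      using b[of i] PiE_arb[OF y, of i] by (auto simp: shifted_def)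
  qed
  have "l (Suc k) \<le> y (n - k) - (n - k) \<and> y (n - k) - (n - k) \<le> l k" if "k \<in> {1..n}" for k
    using b[of "n - k"] that by auto
  then show "(\<lambda>k. if k \<in> {1..n} then y (n - k) - (n - k) else 0) \<in> interlacing n l"
    by (auto simp: interlacing_def)
qed

lemma finite_interlacing: "finite (interlacing n l)"
proof (rule finite_subset)
  show "interlacing n l \<subseteq> {m. \<forall>i. (i \<in> {1..n} \<longrightarrow> m i \<in> {..Max (l ` {1..n})}) \<and> (i \<notin> {1..n} \<longrightarrow> m i = 0)}"
    by (fastforce simp: interlacing_def intro: le_trans[OF _ Max_ge])
  show "finite {m. \<forall>i. (i \<in> {1..n} \<longrightarrow> m i \<in> {..Max (l ` {1..n})}) \<and> (i \<notin> {1..n} \<longrightarrow> m i = 0)}"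
    by (rule finite_set_of_finite_funs) auto
qed

text \<open>The Weyl dimension formula, by induction on the alphabet: splitting by the shape left
  after removing the largest letter gives a sum over interlacing shapes, which
  \<open>vdm_branching\<close> evaluates.\<close>

lemma card_row_families:
  "l \<in> Omega n \<Longrightarrow> finite (row_families n l) \<and>
     real (card (row_families n l)) = V_factor n l / (\<Prod>j<n. fact j)"
proof (induction n arbitrary: l)
  case 0
  then have "l = (\<lambda>_. 0)" by (auto simp: Omega_def)
  then have "row_families 0 l = {\<lambda>_. []}" by (auto simp: row_families_def)
  then show ?case by (simp add: V_factor_eq_vdm vdm_def)
next
  case (Suc n)
  note bij = bij_betw_restrict_rows[OF Suc.prems]
  have IH: "finite (row_families n m)" "real (card (row_families n m)) = V_factor n m / (\<Prod>j<n. fact j)"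
    if "m \<in> interlacing n l" for m
    using Suc.IH[OF interlacing_Omega[OF Suc.prems that]] by auto
  have "finite (\<Union>m\<in>interlacing n l. row_families n m)"
    using IH finite_interlacing by auto
  then have fin: "finite (row_families (Suc n) l)" using bij_betw_finite[OF bij] by simp
  have "row_families n m \<inter> row_families n m' = {}" if "m \<noteq> m'" for m m'
    using that by (auto simp: row_families_def fun_eq_iff)
  then have "card (row_families (Suc n) l) = (\<Sum>m\<in>interlacing n l. card (row_families n m))"
    unfolding bij_betw_same_card[OF bij]
    using IH finite_interlacing by (intro card_UN_disjoint) auto
  then have "real (card (row_families (Suc n) l)) = (\<Sum>m\<in>interlacing n l. vdm n (\<lambda>i. real (shifted n m i))) / (\<Prod>j<n. fact j)"
    using IH(2) by (simp add: sum_divide_distrib V_factor_eq_vdm)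
  also have "\<dots> = vdm (Suc n) (\<lambda>i. real (shifted (Suc n) l i)) / (\<Prod>j<Suc n. fact j)"
  proof (subst vdm_branching)
    fix i assume "i < n"
    then show "shifted (Suc n) l i \<le> shifted (Suc n) l (Suc i)"
      using Omega_antimono[OF Suc.prems, of "n - i" "Suc n - i"]
      by (simp add: shifted_def Suc_diff_le le_SucI)
  qed (simp add: sum_interlacing[OF Suc.prems] sum_divide_distrib)
  finally show ?case using fin by (simp add: V_factor_eq_vdm)
qed

lemma card_ssyts:
  assumes "l \<in> Omega M"
  shows "finite (ssyts M l)" "real (card (ssyts M l)) = V_factor M l / (\<Prod>j<M. fact j)"
  using card_row_families[OF assms] bij_betw_finite[OF bij_betw_tab_rows[OF assms]]
    bij_betw_same_card[OF bij_betw_tab_rows[OF assms]] by auto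

text \<open>The words are grouped by insertion tableau. Every fiber has the same size
  \<open>std_count M l\<close>, so the count is that size times the number of semistandard tableaux;
  each factor contributes one \<open>V_factor\<close>.\<close>

lemma card_words_shape:
  assumes "l \<in> Omega_sum M N"
  shows "real (card {w \<in> words M N. rsk_shape N w = l})
    = fact N * (\<Prod>j=1..M-1. 1 / fact j) * (V_factor M l)\<^sup>2 * W_factor M l"
proof -
  have l: "l \<in> Omega M" "(\<Sum>j=1..M. l j) = N" using assms by (auto simp: Omega_sum_def)
  have "{w \<in> words M N. rsk_shape N w = l} = (\<Union>T\<in>ssyts M l. {w \<in> words M N. fst (rsk N w) = T})"
    using rsk_ssyt[of _ M N] by (auto simp: ssyts_def rsk_shape_def)
  moreover have "card (\<Union>T\<in>ssyts M l. {w \<in> words M N. fst (rsk N w) = T})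
      = (\<Sum>T\<in>ssyts M l. card {w \<in> words M N. fst (rsk N w) = T})"
    using card_ssyts(1)[OF l(1)] by (intro card_UN_disjoint) auto
  ultimately have "real (card {w \<in> words M N. rsk_shape N w = l}) = (\<Sum>T\<in>ssyts M l. std_count M l)"
    using card_rsk_fiber[OF _ assms] by simp
  also have "\<dots> = V_factor M l / (\<Prod>j<M. fact j) * std_count M l"
    using card_ssyts(2)[OF l(1)] by simp
  also have "(\<Prod>j<M. fact j) = (\<Prod>j=1..M-1. fact j :: real)"
  proof (cases M)
    case (Suc m)
    have "(\<Prod>j<Suc m. fact j) = (\<Prod>j=0..m. fact j :: real)" by (simp add: lessThan_Suc_atMost atMost_atLeast0)
    also have "\<dots> = (\<Prod>j=1..m. fact j)" by (simp add: prod.atLeast_Suc_atMost)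
    finally show ?thesis by (simp add: Suc)
  qed simp
  finally show ?thesis
    using l(2) by (simp add: std_count_def prod_dividef power2_eq_square)
qed

section \<open>The Charlier ensemble\<close>

definition charlier_weight :: "nat \<Rightarrow> nat \<Rightarrow> (nat \<Rightarrow> nat) \<Rightarrow> real" where
  "charlier_weight M N l = fact N / real M ^ N * (\<Prod>j=1..M-1. 1 / fact j) * (V_factor M l)\<^sup>2 * W_factor M l"

lemma W_factor_nonneg: "0 \<le> W_factor M l"
  by (auto simp: W_factor_def intro!: prod_nonneg)

lemma charlier_weight_nonneg: "0 \<le> charlier_weight M N l"
  unfolding charlier_weight_def
  by (intro mult_nonneg_nonneg divide_nonneg_nonneg prod_nonneg W_factor_nonneg zero_le_power2) auto

lemma charlier_weight_eq_card:
  assumes "l \<in> Omega_sum M N"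
  shows "charlier_weight M N l = real (card {w \<in> words M N. rsk_shape N w = l}) / real M ^ N"
  unfolding charlier_weight_def card_words_shape[OF assms] by simp

lemma finite_Omega_sum: "finite (Omega_sum M N)"
proof (rule finite_subset)
  show "Omega_sum M N \<subseteq> {l. \<forall>i. (i \<in> {1..M} \<longrightarrow> l i \<in> {..N}) \<and> (i \<notin> {1..M} \<longrightarrow> l i = 0)}"
    by (auto simp: Omega_sum_def Omega_def intro!: member_le_sum)
  show "finite {l. \<forall>i. (i \<in> {1..M} \<longrightarrow> l i \<in> {..N}) \<and> (i \<notin> {1..M} \<longrightarrow> l i = (0::nat))}"
    by (rule finite_set_of_finite_funs) auto
qed

lemma charlier_fixed_eq: "charlier_fixed M N = point_measure (Omega_sum M N) (charlier_weight M N)"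
  by (simp add: charlier_fixed_def charlier_weight_def)

lemma measure_charlier_fixed:
  "A \<subseteq> Omega_sum M N \<Longrightarrow> measure (charlier_fixed M N) A = (\<Sum>l\<in>A. charlier_weight M N l)"
  unfolding charlier_fixed_eq Sigma_Algebra.measure_def
  by (subst emeasure_point_measure_finite) (auto simp: finite_Omega_sum sum_nonneg charlier_weight_nonneg)

lemma measure_word_measure:
  "A \<subseteq> words M N \<Longrightarrow> measure (word_measure M N) A = real (card A) / real M ^ N"
  by (simp add: word_measure_def measure_uniform_count_measure card_words)

lemma measure_word_measure_shape:
  assumes "A \<subseteq> Omega_sum M N"
  shows "measure (word_measure M N) {w \<in> words M N. rsk_shape N w \<in> A} = measure (charlier_fixed M N) A"
proof -
  have "card {w \<in> words M N. rsk_shape N w \<in> A} = card (\<Union>l\<in>A. {w \<in> words M N. rsk_shape N w = l})"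
    by (rule arg_cong[of _ _ card]) auto
  also have "\<dots> = (\<Sum>l\<in>A. card {w \<in> words M N. rsk_shape N w = l})"
    using finite_subset[OF assms finite_Omega_sum] by (intro card_UN_disjoint) auto
  finally have card: "card {w \<in> words M N. rsk_shape N w \<in> A} = \<dots>" .
  have "(\<Sum>l\<in>A. charlier_weight M N l) = (\<Sum>l\<in>A. real (card {w \<in> words M N. rsk_shape N w = l}) / real M ^ N)"
  proof (rule sum.cong[OF refl])
    fix l assume "l \<in> A"
    then show "charlier_weight M N l = real (card {w \<in> words M N. rsk_shape N w = l}) / real M ^ N"
      using assms by (intro charlier_weight_eq_card) blast
  qed
  also have "\<dots> = real (card {w \<in> words M N. rsk_shape N w \<in> A}) / real M ^ N"
    unfolding card of_nat_sum by (rule sum_divide_distrib[symmetric])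
  also have "\<dots> = measure (word_measure M N) {w \<in> words M N. rsk_shape N w \<in> A}"
    by (rule measure_word_measure[symmetric]) auto
  finally show ?thesis
    unfolding measure_charlier_fixed[OF assms] by (rule sym)
qed

lemma measure_longest_increasing:
  "measure (word_measure M N) {w \<in> words M N. real (longest_increasing N w) \<le> t}
     = measure (charlier_fixed M N) {l \<in> Omega_sum M N. real (l 1) \<le> t}"
proof -
  have "{w \<in> words M N. real (longest_increasing N w) \<le> t}
      = {w \<in> words M N. rsk_shape N w \<in> {l \<in> Omega_sum M N. real (l 1) \<le> t}}"
    using rsk_shape_Omega by (auto simp: longest_increasing_eq_shape)
  then show ?thesis by (simp only:) (rule measure_word_measure_shape, auto)
qed

lemma distr_rsk_shape:
  "distr (word_measure M N) (count_space (Omega_sum M N)) (rsk_shape N) = charlier_fixed M N"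
proof (rule measure_eqI_finite[OF _ _ finite_Omega_sum])
  fix l assume l: "l \<in> Omega_sum M N"
  have space: "space (word_measure M N) = words M N"
    by (simp add: word_measure_def space_uniform_count_measure)
  have meas: "rsk_shape N \<in> measurable (word_measure M N) (count_space (Omega_sum M N))"
    using rsk_shape_Omega by (auto simp: word_measure_def uniform_count_measure_def)
  have "emeasure (distr (word_measure M N) (count_space (Omega_sum M N)) (rsk_shape N)) {l}
      = emeasure (word_measure M N) (rsk_shape N -` {l} \<inter> words M N)"
    using emeasure_distr[OF meas, of "{l}"] l by (simp add: space)
  also have "rsk_shape N -` {l} \<inter> words M N = {w \<in> words M N. rsk_shape N w = l}" by auto
  also have "emeasure (word_measure M N) {w \<in> words M N. rsk_shape N w = l} = charlier_weight M N l"
    unfolding charlier_weight_eq_card[OF l] word_measure_def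
    by (subst emeasure_uniform_count_measure) (auto simp: card_words)
  also have "\<dots> = emeasure (charlier_fixed M N) {l}"
    unfolding charlier_fixed_eq using l by (subst emeasure_point_measure_finite) (auto simp: finite_Omega_sum)
  finally show "emeasure (distr (word_measure M N) (count_space (Omega_sum M N)) (rsk_shape N)) {l}
      = emeasure (charlier_fixed M N) {l}" .
qed (simp_all add: charlier_fixed_eq sets_point_measure)

text \<open>On shapes of size \<open>n\<close> the powers combine to
  \<open>(\<alpha> / M) ^ n\<close> and the \<open>M\<close> exponentials to
  \<open>exp (- \<alpha>)\<close>, so both densities differ only by the Poisson weight of
  \<open>n\<close>.\<close>

lemma emeasure_charlier_slice:
  assumes "\<alpha> > 0" "M \<ge> 1" "A \<subseteq> Omega_sum M n"
  shows "emeasure (charlier \<alpha> M) A = ennreal (exp (- \<alpha>) * \<alpha> ^ n / fact n * measure (charlier_fixed M n) A)"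
proof -
  have fin: "finite A" using assms(3) finite_Omega_sum by (rule finite_subset)
  have "(\<Prod>j=1..M-1. 1 / fact j) * (V_factor M l)\<^sup>2 * W_factor M l *
        (\<Prod>i=1..M. (\<alpha> / real M) ^ l i * exp (- \<alpha> / real M))
      = exp (- \<alpha>) * \<alpha> ^ n / fact n * charlier_weight M n l" if "l \<in> A" for l
  proof -
    have sum: "(\<Sum>i=1..M. l i) = n" using that assms(3) by (auto simp: Omega_sum_def)
    have "(\<Prod>i=1..M. (\<alpha> / real M) ^ l i * exp (- \<alpha> / real M)) = (\<alpha> / real M) ^ n * exp (- \<alpha>)"
      using assms(2) unfolding sum[symmetric] power_sum
      by (simp add: prod.distrib flip: exp_of_nat_mult)
    then show ?thesis by (simp add: charlier_weight_def power_divide)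
  qed
  then have "emeasure (charlier \<alpha> M) A = (\<Sum>l\<in>A. ennreal (exp (- \<alpha>) * \<alpha> ^ n / fact n * charlier_weight M n l))"
    unfolding charlier_def using assms(3) fin
    by (subst emeasure_point_measure_finite2) (auto simp: Omega_sum_def)
  also have "\<dots> = ennreal (\<Sum>l\<in>A. exp (- \<alpha>) * \<alpha> ^ n / fact n * charlier_weight M n l)"
    using assms(1) by (intro sum_ennreal) (auto simp: charlier_weight_nonneg)
  finally show ?thesis by (simp add: measure_charlier_fixed[OF assms(3)] sum_distrib_left)
qed

lemma poisson_weights_sums:
  fixes \<alpha> :: real
  shows "(\<lambda>n. exp (- \<alpha>) * \<alpha> ^ n / fact n) sums 1"
proof -
  have "exp (- \<alpha>) * (\<alpha> ^ n /\<^sub>R fact n) = exp (- \<alpha>) * \<alpha> ^ n / fact n" for n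
    by (simp add: divide_inverse)
  moreover have "exp (- \<alpha>) * exp \<alpha> = 1" by (simp flip: exp_add)
  ultimately show ?thesis using sums_mult[OF exp_converges[of \<alpha>], of "exp (- \<alpha>)"] by simp
qed

text \<open>Countable additivity over the size of the shape. Summability, by comparison with the
  Poisson weights, is what allows the \<open>ennreal\<close> series to be replaced by a real
  one.\<close>

lemma charlier_sums:
  fixes P :: "(nat \<Rightarrow> nat) \<Rightarrow> bool"
  assumes "\<alpha> > 0" "M \<ge> 1"
  defines "a \<equiv> \<lambda>n. exp (- \<alpha>) * \<alpha> ^ n / fact n * measure (charlier_fixed M n) {l \<in> Omega_sum M n. P l}"
  shows "emeasure (charlier \<alpha> M) {l \<in> Omega M. P l} = ennreal (suminf a)" "summable a"
proof -
  \<comment> \<open>Transported back to words, the mass is a proportion of all words.\<close>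
  have le1: "measure (charlier_fixed M n) {l \<in> Omega_sum M n. P l} \<le> 1" for n
    unfolding measure_word_measure_shape[symmetric, of "{l \<in> Omega_sum M n. P l}" M n, simplified]
    using card_mono[of "words M n" "{w \<in> words M n. rsk_shape n w \<in> Omega_sum M n \<and> P (rsk_shape n w)}"] assms(2)
    by (subst measure_word_measure) (auto simp: card_words divide_le_eq_1 simp flip: of_nat_power)
  have nonneg: "0 \<le> a n" for n using assms(1) by (simp add: a_def)
  show summable: "summable a"
  proof (rule summable_comparison_test[OF _ sums_summable[OF poisson_weights_sums]], intro exI allI impI)
    fix n
    show "norm (a n) \<le> exp (- \<alpha>) * \<alpha> ^ n / fact n"
      using nonneg[of n] mult_left_le[OF le1[of n], of "exp (- \<alpha>) * \<alpha> ^ n / fact n"] assms(1)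
      by (simp add: a_def)
  qed
  have "{l \<in> Omega M. P l} = (\<Union>n. {l \<in> Omega_sum M n. P l})"
    by (auto simp: Omega_sum_def)
  also have "emeasure (charlier \<alpha> M) \<dots> = (\<Sum>n. emeasure (charlier \<alpha> M) {l \<in> Omega_sum M n. P l})"
    by (rule suminf_emeasure[symmetric])
       (auto simp: charlier_def sets_point_measure Omega_sum_def disjoint_family_on_def)
  also have "\<dots> = (\<Sum>n. ennreal (a n))"
    unfolding a_def using assms(1,2) by (intro suminf_cong emeasure_charlier_slice) auto
  also have "\<dots> = ennreal (suminf a)"
    by (rule suminf_ennreal2[OF nonneg summable])
  finally show "emeasure (charlier \<alpha> M) {l \<in> Omega M. P l} = ennreal (suminf a)" .
qed

text \<open>Each fixed-size measure has total mass 1, because every word has a shape in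
  \<open>Omega_sum M n\<close>; the total mass is therefore the sum of the Poisson weights.\<close>

lemma prob_space_charlier:
  assumes "\<alpha> > 0" "M \<ge> 1"
  shows "prob_space (charlier \<alpha> M)"
proof
  have "measure (charlier_fixed M n) (Omega_sum M n) = 1" for n
  proof -
    have "{w \<in> words M n. rsk_shape n w \<in> Omega_sum M n} = words M n" using rsk_shape_Omega by auto
    then show ?thesis
      using measure_word_measure_shape[of "Omega_sum M n" M n] assms(2)
      by (simp add: measure_word_measure card_words)
  qed
  then have "emeasure (charlier \<alpha> M) (Omega M) = 1"
    using charlier_sums(1)[OF assms, of "\<lambda>_. True"] poisson_weights_sums[of \<alpha>] by (simp add: sums_iff)
  then show "emeasure (charlier \<alpha> M) (space (charlier \<alpha> M)) = 1"
    by (simp add: charlier_def space_point_measure)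
qed

theorem proposition1p5:
  fixes M N :: nat
  assumes "M \<ge> 1" and "N \<ge> 1"
  shows "rsk_shape N \<in> words M N \<rightarrow> Omega_sum M N
       \<and> distr (word_measure M N) (count_space (Omega_sum M N)) (rsk_shape N) = charlier_fixed M N
       \<and> (\<forall>l \<in> Omega_sum M N.
           measure (word_measure M N) {w \<in> words M N. rsk_shape N w = l}
             = measure (charlier_fixed M N) {l}
         \<and> measure (charlier_fixed M N) {l}
             = fact N / real M ^ N * (\<Prod>j=1..M-1. 1 / fact j) * (V_factor M l)\<^sup>2 * W_factor M l)
       \<and> (\<forall>\<alpha>>0. prob_space (charlier \<alpha> M))
       \<and> (\<forall>\<alpha>>0. \<forall>n. \<forall>l \<in> Omega M. (\<Sum>j=1..M. l j) = n \<longrightarrow>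
           exp (- \<alpha>) * \<alpha> ^ n / fact n * measure (charlier_fixed M n) {l}
             = measure (charlier \<alpha> M) {l})
       \<and> (\<forall>t::real.
           measure (word_measure M N) {w \<in> words M N. real (longest_increasing N w) \<le> t}
             = measure (charlier_fixed M N) {l \<in> Omega_sum M N. real (l 1) \<le> t})
       \<and> (\<forall>\<alpha>>0. \<forall>t::real.
           (\<lambda>n. exp (- \<alpha>) * \<alpha> ^ n / fact n *
                 measure (word_measure M n) {w \<in> words M n. real (longest_increasing n w) \<le> t})
             sums measure (charlier \<alpha> M) {l \<in> Omega M. real (l 1) \<le> t})"
proof (intro conjI ballI allI impI)
  show "rsk_shape N \<in> words M N \<rightarrow> Omega_sum M N"
    using rsk_shape_Omega by auto
  show "distr (word_measure M N) (count_space (Omega_sum M N)) (rsk_shape N) = charlier_fixed M N"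
    by (rule distr_rsk_shape)
next
  fix l assume "l \<in> Omega_sum M N"
  then show "measure (word_measure M N) {w \<in> words M N. rsk_shape N w = l} = measure (charlier_fixed M N) {l}"
    using measure_word_measure_shape[of "{l}" M N] by simp
  show "measure (charlier_fixed M N) {l}
      = fact N / real M ^ N * (\<Prod>j=1..M-1. 1 / fact j) * (V_factor M l)\<^sup>2 * W_factor M l"
    using \<open>l \<in> Omega_sum M N\<close> by (simp add: measure_charlier_fixed charlier_weight_def)
next
  fix \<alpha> :: real assume "\<alpha> > 0"
  then show "prob_space (charlier \<alpha> M)" using assms(1) by (rule prob_space_charlier)
next
  fix \<alpha> :: real and n l assume "\<alpha> > 0" "l \<in> Omega M" "(\<Sum>j=1..M. l j) = n"
  then show "exp (- \<alpha>) * \<alpha> ^ n / fact n * measure (charlier_fixed M n) {l} = measure (charlier \<alpha> M) {l}"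
    using emeasure_charlier_slice[of \<alpha> M "{l}" n] assms(1)
    by (simp add: Sigma_Algebra.measure_def[of "charlier \<alpha> M"] Omega_sum_def)
next
  fix t :: real
  show "measure (word_measure M N) {w \<in> words M N. real (longest_increasing N w) \<le> t}
      = measure (charlier_fixed M N) {l \<in> Omega_sum M N. real (l 1) \<le> t}"
    by (rule measure_longest_increasing)
next
  fix \<alpha> t :: real assume "\<alpha> > 0"
  define a where "a n = exp (- \<alpha>) * \<alpha> ^ n / fact n * measure (charlier_fixed M n) {l \<in> Omega_sum M n. real (l 1) \<le> t}" for n
  note sums = charlier_sums[OF \<open>\<alpha> > 0\<close> assms(1), of "\<lambda>l. real (l 1) \<le> t", folded a_def]
  \<comment> \<open>Nonnegativity is needed to read the real value back from
    \<open>ennreal (suminf a)\<close>.\<close>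
  have "0 \<le> suminf a" using \<open>\<alpha> > 0\<close> by (intro suminf_nonneg sums(2)) (simp add: a_def)
  then have "measure (charlier \<alpha> M) {l \<in> Omega M. real (l 1) \<le> t} = suminf a"
    using sums(1) by (simp add: Sigma_Algebra.measure_def)
  \<comment> \<open>The length event is replaced by the first-row event for every \<open>n\<close>,
    including the empty word at \<open>n = 0\<close>.\<close>
  then show "(\<lambda>n. exp (- \<alpha>) * \<alpha> ^ n / fact n *
        measure (word_measure M n) {w \<in> words M n. real (longest_increasing n w) \<le> t})
      sums measure (charlier \<alpha> M) {l \<in> Omega M. real (l 1) \<le> t}"
    unfolding measure_longest_increasing a_def[symmetric] using sums(2) by (simp add: summable_sums)
qed

end
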